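(* Let $K,L,M,N$ be non-negative integers with $K\le M+N$ and $N\le K+L$, and let $(l_T,t,r_T;r_B,b,l_B)$ be a sextuple of $01$-words of lengths $(K,L,M;N,K+L-N,M+N-K)$ respectively. If there exists an oriented hexagonal fully packed loop configuration (oriented HFPL) of size $(K,L,M,N)$ with boundary $(l_T,t,r_T;r_B,b,l_B)$, then: (1) $|l_T|_0+|t|_0=|r_B|_0+|b|_0$ and $|t|_1+|r_T|_1=|b|_1+|l_B|_1$; (2) $l_T\,t\le b\,r_B$ and $t\,r_T\le l_B\,b$, where juxtaposition denotes concatenation of words; (3) $d(r_B)+d(b)+d(l_B)\ \ge\ d(l_T)+d(t)+d(r_T)+|l_T|_1|t|_0+|t|_1|r_T|_0+|r_B|_0|l_B|_1$.
   Context: Words. A word is a finite sequence over $\{0,1\}$; $|\omega|_i$ is the number of occurrences of $i$ in $\omega$; $d(\omega)$ is the number of pairs $i<j$ with $\omega_i=1,\omega_j=0$. For words $\omega,\sigma$ of the same length $n$ with the same number of ones, $\omega\le\sigma$ means $|\omega_1\cdots\omega_m|_1\le|\sigma_1\cdots\sigma_m|_1$ for all $1\le m\le n$. Graph. Let $K,L,M,N\ge0$ be integers with $K\le M+N$, $N\le K+L$, and $M+N\ge 1$. $H^{K,L,M,N}$ is the induced subgraph of the square lattice $\mathbb Z^2$ (edges join points at distance 1) on the vertices $(x,y)\in\mathbb Z^2$ with $y\le x$, $y\le K-1$, $y\le -x+2(K+L)$, $y\ge -x-1$, $y\ge -M-N+K$, $y\ge x-2(M+L)-1$. A vertex $(x,y)$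 is called odd if $x+y$ is an even integer, and even if $x+y$ is an odd integer (so, for $K\geq 1$, the leftmost vertex of the top row is odd). Put $s=M+N-K$. Distinguished vertices: $\mathcal L_T=\{L_{T,i}=(i-1,i-1):1\le i\le K\}$ (leftmost vertices of the top $K$ rows); $\mathcal T=\{T_i=(K-1+2i,K-1):1\le i\le L\}$ (odd vertices of the top row not in $\mathcal L_T\cup\mathcal R_T$); $\mathcal R_T=\{R_{T,i}=(K+2L+i,K-i):1\le i\le M\}$ (rightmost vertices of the top $M$ rows); $\mathcal L_B=\{L_{B,i}=(i-1,-i):1\le i\le s\}$ (leftmost vertices of the bottom $s$ rows); $\mathcal B=\{B_i=(s-1+2i,-s):1\le i\le K+L-N\}$ (even vertices of the bottom row not in $\mathcal L_B\cup\mathcal R_B$); $\mathcal R_B=\{R_{B,i}=(K+M-N+2L+i,\,K-M-N-1+i):1\le i\le N\}$ (rightmost vertices of the bottom $N$ rows). HFPL. An HFPL of size $(K,L,M,N)$ is a spanning subgraph $f$ of $H^{K,L,M,N}$ such that vertices in $\mathcal L_B\cup\mathcal L_T\cup\mathcal R_B\cup\mathcal R_T$ have degree 0 or 1, vertices in $\mathcal T\cup\mathcal B$ have degree 1, all other vertices have degree 2, and no path of $f$ joins two vertices of $\mathcal L_B\cup\mathcal L_T$ or two vertices of $\mathcal R_B\cup\mathcal R_T$. Oriented HFPL. An HFPL with an orientation of each edge such that each vertex of degree 2 has one incoming and one outgoing edge, each edge attached to a vertex of $\mathcal L_T\cup\mathcal L_B$ is outgoing from it, and each edge attached to a vertex of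 $\mathcal R_T\cup\mathcal R_B$ is incoming to it. Its boundary $(l_T,t,r_T;r_B,b,l_B)$ is given by: $(l_T)_i=1$ if $L_{T,i}$ has out-degree 1, else 0; $t_i=0$ if $T_i$ has in-degree 1, else 1; $(r_T)_i=0$ if $R_{T,i}$ has in-degree 1, else 1; $(r_B)_i=1$ if $R_{B,i}$ has in-degree 1, else 0; $b_i=1$ if $B_i$ has in-degree 1, else 0; $(l_B)_i=0$ if $L_{B,i}$ has out-degree 1, else 1. *)

theory Defs
  imports Main "HOL-Library.Z2"
begin

section \<open>Words over \<open>{0,1}\<close>\<close>

type_synonym word = "bit list"

definition inv_number :: "word \<Rightarrow> nat" where
  "inv_number w = card {(i, j). i < j \<and> j < length w \<and> w ! i = 1 \<and> w ! j = 0}"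

definition word_le :: "word \<Rightarrow> word \<Rightarrow> bool" where
  "word_le w v \<longleftrightarrow> length w = length v \<and> count_list w 1 = count_list v 1 \<and>
     (\<forall>m. 1 \<le> m \<and> m \<le> length w \<longrightarrow> count_list (take m w) 1 \<le> count_list (take m v) 1)"

section \<open>The hexagonal graph\<close>

type_synonym vertex = "int \<times> int"

definition lattice_edges :: "vertex set set" where
  "lattice_edges = {{(x, y), (x', y')} | x y x' y'. \<bar>x - x'\<bar> + \<bar>y - y'\<bar> = 1}"

definition H_verts :: "nat \<Rightarrow> nat \<Rightarrow> nat \<Rightarrow> nat \<Rightarrow> vertex set" where
  "H_verts K L M N = {(x, y).
      y \<le> x \<and>
      y \<le> int K - 1 \<and>
      y \<le> - x + 2 * (int K + int L) \<and>
      y \<ge> - x - 1 \<and>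
      y \<ge> - int M - int N + int K \<and>
      y \<ge> x - 2 * (int M + int L) - 1}"

definition H_edges :: "nat \<Rightarrow> nat \<Rightarrow> nat \<Rightarrow> nat \<Rightarrow> vertex set set" where
  "H_edges K L M N = {e \<in> lattice_edges. e \<subseteq> H_verts K L M N}"

text \<open>The distinguished vertices are indexed from 1.\<close>

definition L_T :: "nat \<Rightarrow> vertex" where
  "L_T i = (int i - 1, int i - 1)"

definition T_top :: "nat \<Rightarrow> nat \<Rightarrow> vertex" where
  "T_top K i = (int K - 1 + 2 * int i, int K - 1)"

definition R_T :: "nat \<Rightarrow> nat \<Rightarrow> nat \<Rightarrow> vertex" where
  "R_T K L i = (int K + 2 * int L + int i, int K - int i)"

definition L_B :: "nat \<Rightarrow> vertex" where
  "L_B i = (int i - 1, - int i)"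

definition B_bot :: "nat \<Rightarrow> nat \<Rightarrow> nat \<Rightarrow> nat \<Rightarrow> vertex" where
  "B_bot K M N i = (let s = int M + int N - int K in (s - 1 + 2 * int i, - s))"

definition R_B :: "nat \<Rightarrow> nat \<Rightarrow> nat \<Rightarrow> nat \<Rightarrow> nat \<Rightarrow> vertex" where
  "R_B K L M N i =
     (int K + int M - int N + 2 * int L + int i, int K - int M - int N - 1 + int i)"

definition left_verts :: "nat \<Rightarrow> nat \<Rightarrow> nat \<Rightarrow> nat \<Rightarrow> vertex set" where
  "left_verts K L M N = L_B ` {1..M + N - K} \<union> L_T ` {1..K}"

definition right_verts :: "nat \<Rightarrow> nat \<Rightarrow> nat \<Rightarrow> nat \<Rightarrow> vertex set" where
  "right_verts K L M N = R_B K L M N ` {1..N} \<union> R_T K L ` {1..M}"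

definition top_bottom_verts :: "nat \<Rightarrow> nat \<Rightarrow> nat \<Rightarrow> nat \<Rightarrow> vertex set" where
  "top_bottom_verts K L M N = T_top K ` {1..L} \<union> B_bot K M N ` {1..K + L - N}"

section \<open>Hexagonal fully packed loop configurations\<close>

text \<open>A spanning subgraph is represented by its edge set.\<close>

definition degree :: "vertex set set \<Rightarrow> vertex \<Rightarrow> nat" where
  "degree f v = card {e \<in> f. v \<in> e}"

definition joins_path :: "vertex set set \<Rightarrow> vertex list \<Rightarrow> vertex \<Rightarrow> vertex \<Rightarrow> bool" where
  "joins_path f p u v \<longleftrightarrow> p \<noteq> [] \<and> hd p = u \<and> last p = v \<and> distinct p \<and>
     (\<forall>i. Suc i < length p \<longrightarrow> {p ! i, p ! Suc i} \<in> f)"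

definition no_path_joins_two :: "vertex set set \<Rightarrow> vertex set \<Rightarrow> bool" where
  "no_path_joins_two f S \<longleftrightarrow>
     (\<forall>u\<in>S. \<forall>v\<in>S. u \<noteq> v \<longrightarrow> \<not> (\<exists>p. joins_path f p u v))"

definition hfpl :: "nat \<Rightarrow> nat \<Rightarrow> nat \<Rightarrow> nat \<Rightarrow> vertex set set \<Rightarrow> bool" where
  "hfpl K L M N f \<longleftrightarrow>
     f \<subseteq> H_edges K L M N \<and>
     (\<forall>v \<in> left_verts K L M N \<union> right_verts K L M N. degree f v \<in> {0, 1}) \<and>
     (\<forall>v \<in> top_bottom_verts K L M N. degree f v = 1) \<and>
     (\<forall>v \<in> H_verts K L M N -
        (left_verts K L M N \<union> right_verts K L M N \<union> top_bottom_verts K L M N). degree f v = 2) \<and>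
     no_path_joins_two f (left_verts K L M N) \<and>
     no_path_joins_two f (right_verts K L M N)"

section \<open>Oriented configurations and their boundary\<close>

text \<open>An arc \<open>(u, v)\<close> is the edge \<open>{u, v}\<close> directed from \<open>u\<close> to \<open>v\<close>.\<close>

definition orientation_of :: "vertex set set \<Rightarrow> (vertex \<times> vertex) set \<Rightarrow> bool" where
  "orientation_of f A \<longleftrightarrow>
     f = {{u, v} | u v. (u, v) \<in> A} \<and> (\<forall>u v. (u, v) \<in> A \<longrightarrow> (v, u) \<notin> A)"

definition in_deg :: "(vertex \<times> vertex) set \<Rightarrow> vertex \<Rightarrow> nat" where
  "in_deg A v = card {a \<in> A. snd a = v}"

definition out_deg :: "(vertex \<times> vertex) set \<Rightarrow> vertex \<Rightarrow> nat" where
  "out_deg A v = card {a \<in> A. fst a = v}"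

definition oriented_hfpl ::
  "nat \<Rightarrow> nat \<Rightarrow> nat \<Rightarrow> nat \<Rightarrow> vertex set set \<Rightarrow> (vertex \<times> vertex) set \<Rightarrow> bool" where
  "oriented_hfpl K L M N f A \<longleftrightarrow>
     hfpl K L M N f \<and> orientation_of f A \<and>
     (\<forall>v \<in> H_verts K L M N. degree f v = 2 \<longrightarrow> in_deg A v = 1 \<and> out_deg A v = 1) \<and>
     (\<forall>(u, v) \<in> A. v \<notin> left_verts K L M N) \<and>
     (\<forall>(u, v) \<in> A. u \<notin> right_verts K L M N)"

text \<open>
  The boundary \<open>(l_T, t, r_T, r_B, b, l_B)\<close>; list position \<open>i - 1\<close> of a word holds its
  letter with index \<open>i\<close>.
\<close>

definition boundary ::
  "nat \<Rightarrow> nat \<Rightarrow> nat \<Rightarrow> nat \<Rightarrow> (vertex \<times> vertex) set \<Rightarrow>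
     word \<times> word \<times> word \<times> word \<times> word \<times> word" where
  "boundary K L M N A =
    (map (\<lambda>i. if out_deg A (L_T i) = 1 then 1 else 0) [1..<K + 1],
     map (\<lambda>i. if in_deg A (T_top K i) = 1 then 0 else 1) [1..<L + 1],
     map (\<lambda>i. if in_deg A (R_T K L i) = 1 then 0 else 1) [1..<M + 1],
     map (\<lambda>i. if in_deg A (R_B K L M N i) = 1 then 1 else 0) [1..<N + 1],
     map (\<lambda>i. if in_deg A (B_bot K M N i) = 1 then 1 else 0) [1..<K + L - N + 1],
     map (\<lambda>i. if out_deg A (L_B i) = 1 then 0 else 1) [1..<M + N - K + 1])"

end

theory Submission
  imports Defs
begin

text \<open>
  The arcs from odd to even vertices (paper's parity: odd means even coordinate sum) and those from
  even to odd vertices form two disjoint matchings of the hexagon. Counting matched vertices on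
  either side of a line \<open>x + y = c\<close> (first matching) or \<open>x - y = c\<close> (second matching) expresses the
  difference of the number of zeros in prefixes of the boundary words as the number of arcs crossing
  that line; this gives the equalities and the dominance relations, and, summed over all lines, the
  differences \<open>d(b r_B) - d(l_T t)\<close> and \<open>d(l_B b) - d(t r_T)\<close> as numbers of arcs of prescribed directions.

  Superposing each matching with a reference matching by horizontal edges gives two families of
  lattice paths, one running to the left and one to the right. The signed number of their crossings
  is determined by the boundary words; locally, each crossing uses one of the arcs counted above,
  because the two matchings are disjoint.
\<close>

subsection \<open>Inversions and prefixes of words\<close>

text \<open>Adding \<open>d(b r_B) - d(l_T t)\<close> and \<open>d(l_B b) - d(t r_T)\<close> does
  not give the last inequality: the sum contains \<open>d(b)\<close> and \<open>d(t)\<close> twice,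
  and the product \<open>|r_B|_0 |l_B|_1\<close> is absent from it. The crossing number repairs
  both. The paths of the first family end at the zeros of \<open>l_T\<close>, \<open>t\<close>,
  \<open>b\<close>, \<open>r_B\<close>, those of the second at the ones of \<open>l_B\<close>,
  \<open>t\<close>, \<open>b\<close>, \<open>r_T\<close>, which makes the signed number of crossings
  equal to \<open>(|t|_1 + |r_T|_1)(|l_T|_0 + |t|_0) - |b|_0 |b|_1 + d(b) - d(t)\<close>. By the
  equalities of part (1) the leading product is also
  \<open>(|l_B|_1 + |b|_1)(|b|_0 + |r_B|_0)\<close>. Its expansion contains the wanted term, and its
  other terms cancel against \<open>|b|_0 |b|_1\<close> and the products that arise when
  \<open>d\<close> is split over the concatenations. Only an upper bound on the crossing number is
  needed, so crossings of negative sign do no harm.\<close>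

lemma bit_not_one_iff: "b \<noteq> 1 \<longleftrightarrow> b = (0::bit)" by (cases b) auto

lemma count_list_bit_length: "count_list w 0 + count_list w 1 = length (w::word)"
  by (induction w) (auto simp: bit_not_one_iff)

lemma inv_number_Nil [simp]: "inv_number [] = 0"
  by (simp add: inv_number_def)

lemma count_list_card: "count_list w a = card {i. i < length w \<and> w ! i = a}"
  by (simp add: count_list_eq_length_filter length_filter_conv_card eq_commute)

lemma finite_inversions: "finite {(i, j). i < j \<and> j < length w \<and> w ! i = (1::bit) \<and> w ! j = 0}"
  by (rule finite_subset[of _ "{..<length w} \<times> {..<length w}"]) auto

lemma inv_number_snoc:
  "inv_number (w @ [a]) = inv_number w + (if a = 0 then count_list w 1 else 0)"
proof -
  let ?I = "\<lambda>w. {(i, j). i < j \<and> j < length w \<and> w ! i = (1::bit) \<and> w ! j = 0}"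
  let ?N = "(\<lambda>i. (i, length w)) ` {i. i < length w \<and> w ! i = 1 \<and> a = 0}"
  have "?I (w @ [a]) = ?I w \<union> ?N"
    by (auto simp: nth_append split: if_splits)
  moreover have "?I w \<inter> ?N = {}" by auto
  ultimately have "inv_number (w @ [a]) = inv_number w + card ?N"
    unfolding inv_number_def using finite_inversions[of w]
    by (simp add: card_Un_disjoint del: card_image)
  moreover have "card ?N = (if a = 0 then count_list w 1 else 0)"
    by (subst card_image) (auto simp: inj_on_def count_list_card)
  ultimately show ?thesis by simp
qed

lemma inv_number_append:
  "inv_number (u @ v) = inv_number u + inv_number v + count_list u 1 * count_list v 0"
proof (induction v rule: rev_induct)
  case (snoc a v)
  have "inv_number (u @ v @ [a]) = inv_number (u @ v) + (if a = 0 then count_list (u @ v) 1 else 0)"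
    using inv_number_snoc[of "u @ v" a] by simp
  with snoc show ?case by (auto simp: inv_number_snoc algebra_simps)
qed simp

text \<open>A zero at position \<open>p\<close>, counted from 1, lies in
  \<open>length w - p + 1\<close> prefixes, and \<open>p\<close> is its rank among the zeros plus
  the number of ones before it. Summing over the zeros gives the identity; doubling removes the half
  in the sum of the ranks, and all terms are placed so that no subtraction of naturals
  occurs.\<close>

lemma inv_number_prefix_sum:
  "2 * inv_number w + 2 * (\<Sum>k\<le>length w. count_list (take k w) 0) + count_list w 0 ^ 2
    = 2 * length w * count_list w 0 + count_list w 0"
proof (induction w rule: rev_induct)
  case (snoc a w)
  have "(\<Sum>k\<le>length (w @ [a]). count_list (take k (w @ [a])) 0)
      = (\<Sum>k\<le>length w. count_list (take k w) 0) + count_list w 0 + of_bool (a = 0)"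
    by simp
  moreover note count_list_bit_length[of w]
  ultimately show ?case using snoc
    by (auto simp: inv_number_snoc algebra_simps power2_eq_square)
qed simp

text \<open>For equal lengths and equal numbers of zeros all other terms of
  \<open>inv_number_prefix_sum\<close> cancel. This turns inversion counts into prefix counts, which
  are what a diagonal cut measures.\<close>

lemma inv_number_diff:
  assumes "length w = length v" and "count_list w 0 = count_list v 0"
  shows "int (inv_number v) - int (inv_number w)
    = (\<Sum>k\<le>length w. int (count_list (take k w) 0) - int (count_list (take k v) 0))"
  using inv_number_prefix_sum[of w] inv_number_prefix_sum[of v] assms
  unfolding sum_subtractf by (simp flip: of_nat_sum)

lemma word_leI:
  assumes "length w = length v"
    and "\<And>k. k \<le> length w \<Longrightarrow> count_list (take k v) 0 \<le> count_list (take k w) 0"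
    and "count_list w 0 = count_list v 0"
  shows "word_le w v"
proof -
  have "count_list (take k w) 1 \<le> count_list (take k v) 1" if "k \<le> length w" for k
    using assms(2)[OF that] count_list_bit_length[of "take k w"]
      count_list_bit_length[of "take k v"] assms(1) that by simp
  moreover have "count_list w 1 = count_list v 1"
    using count_list_bit_length[of w] count_list_bit_length[of v] assms by simp
  ultimately show ?thesis using assms(1) unfolding word_le_def by blast
qed

subsection \<open>Crossings of planar flows\<close>

lemma sum_int_telescope:
  fixes F :: "int \<Rightarrow> int"
  assumes "a \<le> b"
  shows "(\<Sum>y\<in>{a..<b}. F (y + 1) - F y) = F b - F a"
  using assms
proof (induction b rule: int_ge_induct)
  case (step i)
  then have "{a..<i + 1} = insert i {a..<i}" by auto
  with step show ?case by simp
qed simp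

text \<open>
  Discrete integration by parts for two conserved flows on the square lattice: \<open>g\<close> is the flow
  through the edge to the right of a vertex, \<open>v\<close> the upward flow through the edge below it, and \<open>h\<close>
  the height function of the first flow.
\<close>

lemma crossing_sum:
  fixes g1 g2 v1 v2 :: "int \<Rightarrow> int \<Rightarrow> int" and x0 x1 y0 y1 :: int
  assumes xs: "x0 \<le> x1" and ys: "y0 \<le> y1"
    and c1: "\<And>x y. x \<in> {x0..<x1} \<Longrightarrow> y \<in> {y0..<y1} \<Longrightarrow> g1 (x - 1) y + v1 x y = g1 x y + v1 x (y + 1)"
    and c2: "\<And>x y. x \<in> {x0..<x1} \<Longrightarrow> y \<in> {y0..<y1} \<Longrightarrow> g2 (x - 1) y + v2 x y = g2 x y + v2 x (y + 1)"
    and h: "\<And>x y. h x y = (\<Sum>x'\<in>{x0..<x}. v1 x' y) - (\<Sum>y'\<in>{y0..<y}. g1 (x0 - 1) y')"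
  shows "(\<Sum>x\<in>{x0..<x1}. h x y1 * v2 x y1) - (\<Sum>x\<in>{x0..<x1}. h x y0 * v2 x y0)
    = (\<Sum>y\<in>{y0..<y1}. (\<Sum>x\<in>{x0..<x1}. g2 x y * v1 x y - g1 (x - 1) y * v2 x (y + 1))
        + h x0 y * g2 (x0 - 1) y - h x1 y * g2 (x1 - 1) y)"
    and "\<And>y. y \<in> {y0..<y1} \<Longrightarrow> h x1 (y + 1) = h x1 y - g1 (x1 - 1) y"
proof -
  have hx: "h (x + 1) y = h x y + v1 x y" if "x \<in> {x0..<x1}" for x y
  proof -
    have "{x0..<x + 1} = insert x {x0..<x}" using that by auto
    then show ?thesis by (simp add: h)
  qed
  \<comment> \<open>The definition of \<open>h\<close> integrates up the left side and then along
    the row. Conservation of the first flow makes the height independent of the route, so its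
    vertical increment is known in every column.\<close>
  have hy: "h x (y + 1) = h x y - g1 (x - 1) y" if "x0 \<le> x" "x \<le> x1" and y: "y \<in> {y0..<y1}" for x y
    using that(1,2)
  proof (induction x rule: int_ge_induct)
    case base
    have "{y0..<y + 1} = insert y {y0..<y}" using y by auto
    then show ?case by (simp add: h)
  next
    case (step x)
    then show ?case using hx[of x y] hx[of x "y + 1"] c1[of x y] y by simp
  qed
  show "h x1 (y + 1) = h x1 y - g1 (x1 - 1) y" if "y \<in> {y0..<y1}" for y
    using hy[of x1 y] xs that by simp
  have row: "(\<Sum>x\<in>{x0..<x1}. h x (y + 1) * v2 x (y + 1)) - (\<Sum>x\<in>{x0..<x1}. h x y * v2 x y)
    = (\<Sum>x\<in>{x0..<x1}. g2 x y * v1 x y - g1 (x - 1) y * v2 x (y + 1))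
        + h x0 y * g2 (x0 - 1) y - h x1 y * g2 (x1 - 1) y" (is "?l = ?r") if y: "y \<in> {y0..<y1}" for y
  proof -
    \<comment> \<open>Conservation of the second flow eliminates \<open>v2 x y\<close>. What remains
      besides the two local products is the increment of \<open>h x y * g2 (x - 1) y\<close> along
      the row, which telescopes.\<close>
    have "h x (y + 1) * v2 x (y + 1) - h x y * v2 x y
      = (g2 x y * v1 x y - g1 (x - 1) y * v2 x (y + 1))
        - (h (x + 1) y * g2 (x + 1 - 1) y - h x y * g2 (x - 1) y)" if x: "x \<in> {x0..<x1}" for x
    proof -
      have v: "v2 x y = g2 x y + v2 x (y + 1) - g2 (x - 1) y" using c2[OF x y] by simp
      have h': "h x (y + 1) = h x y - g1 (x - 1) y" using hy[of x y] x y by simp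
      show ?thesis unfolding h' hx[OF x] v by (simp add: algebra_simps)
    qed
    then have "?l = (\<Sum>x\<in>{x0..<x1}. (g2 x y * v1 x y - g1 (x - 1) y * v2 x (y + 1))
        - (h (x + 1) y * g2 (x + 1 - 1) y - h x y * g2 (x - 1) y))"
      unfolding sum_subtractf[symmetric] by (rule sum.cong[OF refl])
    also have "\<dots> = ?r"
      using sum_int_telescope[OF xs, of "\<lambda>x. h x y * g2 (x - 1) y"]
      by (simp add: sum_subtractf)
    finally show ?thesis .
  qed
  show "(\<Sum>x\<in>{x0..<x1}. h x y1 * v2 x y1) - (\<Sum>x\<in>{x0..<x1}. h x y0 * v2 x y0)
    = (\<Sum>y\<in>{y0..<y1}. (\<Sum>x\<in>{x0..<x1}. g2 x y * v1 x y - g1 (x - 1) y * v2 x (y + 1))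
        + h x0 y * g2 (x0 - 1) y - h x1 y * g2 (x1 - 1) y)"
    using sum_int_telescope[OF ys, of "\<lambda>y. \<Sum>x\<in>{x0..<x1}. h x y * v2 x y"]
    by (simp add: row)
qed

section \<open>Words read along a horizontal level\<close>

lemma sum_over_positions:
  fixes F V :: "int \<Rightarrow> int"
  assumes "x0 \<le> c" and "c + 2 * int n \<le> x1"
    and "\<And>x. x \<notin> (\<lambda>i. c + 2 * int i) ` {..<n} \<Longrightarrow> V x = 0"
  shows "(\<Sum>x\<in>{x0..<x1}. F x * V x) = (\<Sum>i<n. F (c + 2 * int i) * V (c + 2 * int i))"
proof -
  have "(\<Sum>x\<in>{x0..<x1}. F x * V x) = (\<Sum>x\<in>(\<lambda>i. c + 2 * int i) ` {..<n}. F x * V x)"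
    using assms by (intro sum.mono_neutral_right) auto
  also have "\<dots> = (\<Sum>i<n. F (c + 2 * int i) * V (c + 2 * int i))"
    by (subst sum.reindex) (auto simp: inj_on_def)
  finally show ?thesis .
qed

text \<open>Among the \<open>|w|_0 |w|_1\<close> pairs of a zero and a one, those with the one in
  front are the inversions; the sum counts the others.\<close>

lemma ascents_eq:
  "(\<Sum>j<length w. int (count_list (take j w) 0) * of_bool (w ! j = 1))
    = int (count_list w 0) * int (count_list w 1) - int (inv_number w)"
proof (induction w rule: rev_induct)
  case (snoc a w)
  have "(\<Sum>j<length w. int (count_list (take j (w @ [a])) 0) * of_bool ((w @ [a]) ! j = 1))
    = (\<Sum>j<length w. int (count_list (take j w) 0) * of_bool (w ! j = 1))"
    by (rule sum.cong) (auto simp: nth_append)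
  with snoc show ?case by (auto simp: inv_number_snoc bit_not_one_iff algebra_simps)
qed simp

lemma count_list_take:
  assumes "k \<le> length w"
  shows "int (count_list (take k w) a) = (\<Sum>i<k. of_bool (w ! i = a))"
  using assms
proof (induction k)
  case (Suc k)
  then show ?case by (simp add: take_Suc_conv_app_nth)
qed simp

text \<open>Evaluates the top and bottom terms of \<open>crossing_sum\<close>: the first flow passes
  at the zeros of \<open>w\<close> and the second at the ones, so a one sees as height the zeros to
  its left plus the offset \<open>n\<close>. The spacing is 2 because only one parity class of such
  a row carries letters.\<close>

lemma pair_crossings:
  fixes V1 V2 :: "int \<Rightarrow> int" and w :: word
  assumes b: "x0 \<le> c" "c + 2 * int (length w) \<le> x1"
    and out1: "\<And>x. x \<notin> (\<lambda>i. c + 2 * int i) ` {..<length w} \<Longrightarrow> V1 x = 0"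
    and out2: "\<And>x. x \<notin> (\<lambda>i. c + 2 * int i) ` {..<length w} \<Longrightarrow> V2 x = 0"
    and in1: "\<And>i. i < length w \<Longrightarrow> V1 (c + 2 * int i) = of_bool (w ! i = 0)"
    and in2: "\<And>i. i < length w \<Longrightarrow> V2 (c + 2 * int i) = of_bool (w ! i = 1)"
  shows "(\<Sum>x\<in>{x0..<x1}. ((\<Sum>x'\<in>{x0..<x}. V1 x') + n) * V2 x)
      = int (count_list w 0) * int (count_list w 1) - int (inv_number w) + n * int (count_list w 1)"
    and "(\<Sum>x\<in>{x0..<x1}. V1 x) = int (count_list w 0)"
proof -
  have V1: "(\<Sum>x'\<in>{x0..<c + 2 * int j}. V1 x') = int (count_list (take j w) 0)" if "j \<le> length w" for j
  proof -
    have "(\<Sum>x'\<in>{x0..<c + 2 * int j}. V1 x') = (\<Sum>x\<in>(\<lambda>i. c + 2 * int i) ` {..<j}. V1 x)"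
    proof (intro sum.mono_neutral_right ballI out1)
      show "(\<lambda>i. c + 2 * int i) ` {..<j} \<subseteq> {x0..<c + 2 * int j}" using b by auto
    qed auto
    also have "\<dots> = (\<Sum>i<j. of_bool (w ! i = 0))"
      using in1 that by (subst sum.reindex) (auto simp: inj_on_def intro!: sum.cong)
    finally show ?thesis by (simp add: count_list_take that)
  qed
  have "(\<Sum>x\<in>{x0..<x1}. V1 x) = (\<Sum>x\<in>{x0..<c + 2 * int (length w)}. V1 x)"
    using b by (intro sum.mono_neutral_right ballI out1) auto
  with V1[of "length w"] show "(\<Sum>x\<in>{x0..<x1}. V1 x) = int (count_list w 0)" by simp
  have "(\<Sum>x\<in>{x0..<x1}. ((\<Sum>x'\<in>{x0..<x}. V1 x') + n) * V2 x)
      = (\<Sum>j<length w. ((\<Sum>x'\<in>{x0..<c + 2 * int j}. V1 x') + n) * V2 (c + 2 * int j))"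
    by (rule sum_over_positions) (use b out2 in auto)
  also have "\<dots> = (\<Sum>j<length w. int (count_list (take j w) 0) * of_bool (w ! j = 1)
      + n * of_bool (w ! j = 1))"
    by (rule sum.cong) (auto simp: V1 in2 distrib_right)
  also have "\<dots> = int (count_list w 0) * int (count_list w 1) - int (inv_number w) + n * int (count_list w 1)"
    using count_list_take[of "length w" w 1]
    by (simp add: sum.distrib ascents_eq flip: sum_distrib_left)
  finally show "(\<Sum>x\<in>{x0..<x1}. ((\<Sum>x'\<in>{x0..<x}. V1 x') + n) * V2 x)
      = int (count_list w 0) * int (count_list w 1) - int (inv_number w) + n * int (count_list w 1)" .
qed

text \<open>Here \<open>bij\<close> is the reference matching, which makes \<open>S\<close> and
  \<open>T\<close> equinumerous. Hence the left side is the number of arcs into \<open>T\<close>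
  minus the number of arcs out of \<open>S\<close>, and by \<open>closed\<close> the latter are
  among the former.\<close>

lemma unmatched_difference:
  fixes M :: "('a \<times> 'b) set" and bij :: "'a \<Rightarrow> 'b"
  assumes "finite S" and "finite M" and "inj_on fst M" and "inj_on snd M"
    and "bij_betw bij S T"
    and closed: "\<And>a. a \<in> M \<Longrightarrow> fst a \<in> S \<Longrightarrow> snd a \<in> T"
  shows "int (card {v \<in> S. v \<notin> fst ` M}) - int (card {v \<in> T. v \<notin> snd ` M})
    = int (card {a \<in> M. snd a \<in> T \<and> fst a \<notin> S})"
proof -
  have count: "int (card {v \<in> X. v \<notin> \<pi> ` M}) + int (card {a \<in> M. \<pi> a \<in> X}) = int (card X)"
    if "finite X" "inj_on \<pi> M" for X :: "'c set" and \<pi> :: "'a \<times> 'b \<Rightarrow> 'c"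
  proof -
    have "card X = card ({v \<in> X. v \<notin> \<pi> ` M} \<union> \<pi> ` {a \<in> M. \<pi> a \<in> X})"
      by (rule arg_cong[of _ _ card]) auto
    also have "\<dots> = card {v \<in> X. v \<notin> \<pi> ` M} + card (\<pi> ` {a \<in> M. \<pi> a \<in> X})"
      using that assms(2) by (intro card_Un_disjoint) auto
    also have "card (\<pi> ` {a \<in> M. \<pi> a \<in> X}) = card {a \<in> M. \<pi> a \<in> X}"
      by (intro card_image inj_on_subset[OF that(2)]) auto
    finally show ?thesis by simp
  qed
  have "finite T" "card T = card S"
    using assms(1,5) bij_betw_finite bij_betw_same_card by metis+
  moreover have "card {a \<in> M. snd a \<in> T} = card {a \<in> M. fst a \<in> S} + card {a \<in> M. snd a \<in> T \<and> fst a \<notin> S}"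
    using assms(2) closed by (subst card_Un_disjoint[symmetric]) (auto intro!: arg_cong[of _ _ card])
  ultimately show ?thesis
    using count[OF assms(1,3)] count[OF _ assms(4), of T] by simp
qed

subsection \<open>The hexagon and its boundary\<close>

lemma left_verts_iff:
  assumes "K \<le> M + N" and "N \<le> K + L"
  shows "(x, y) \<in> left_verts K L M N \<longleftrightarrow> (x, y) \<in> H_verts K L M N \<and> (x = y \<or> x = - y - 1)"
proof -
  have "(x, y) \<in> L_T ` {1..K} \<longleftrightarrow> (x, y) \<in> H_verts K L M N \<and> x = y"
  proof
    assume *: "(x, y) \<in> H_verts K L M N \<and> x = y"
    then have "(x, y) = L_T (nat (x + 1))" "nat (x + 1) \<in> {1..K}"
      by (auto simp: L_T_def H_verts_def)
    then show "(x, y) \<in> L_T ` {1..K}" by blast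
  qed (use assms in \<open>auto simp: L_T_def H_verts_def\<close>)
  moreover have "(x, y) \<in> L_B ` {1..M + N - K} \<longleftrightarrow> (x, y) \<in> H_verts K L M N \<and> x = - y - 1"
  proof
    assume *: "(x, y) \<in> H_verts K L M N \<and> x = - y - 1"
    then have "(x, y) = L_B (nat (- y))" "nat (- y) \<in> {1..M + N - K}"
      by (auto simp: L_B_def H_verts_def)
    then show "(x, y) \<in> L_B ` {1..M + N - K}" by blast
  qed (use assms in \<open>auto simp: L_B_def H_verts_def\<close>)
  ultimately show ?thesis unfolding left_verts_def by blast
qed

lemma right_verts_iff:
  assumes "K \<le> M + N" and "N \<le> K + L"
  shows "(x, y) \<in> right_verts K L M N \<longleftrightarrow> (x, y) \<in> H_verts K L M N \<and>
    (x = 2 * (int K + int L) - y \<or> x = y + 2 * (int M + int L) + 1)"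
proof -
  have "(x, y) \<in> R_T K L ` {1..M} \<longleftrightarrow> (x, y) \<in> H_verts K L M N \<and> x = 2 * (int K + int L) - y"
  proof
    assume *: "(x, y) \<in> H_verts K L M N \<and> x = 2 * (int K + int L) - y"
    then have "(x, y) = R_T K L (nat (int K - y))" "nat (int K - y) \<in> {1..M}"
      by (auto simp: R_T_def H_verts_def)
    then show "(x, y) \<in> R_T K L ` {1..M}" by blast
  qed (use assms in \<open>auto simp: R_T_def H_verts_def\<close>)
  moreover have "(x, y) \<in> R_B K L M N ` {1..N} \<longleftrightarrow> (x, y) \<in> H_verts K L M N \<and> x = y + 2 * (int M + int L) + 1"
  proof
    assume *: "(x, y) \<in> H_verts K L M N \<and> x = y + 2 * (int M + int L) + 1"
    then have "(x, y) = R_B K L M N (nat (y - int K + int M + int N + 1))"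
      "nat (y - int K + int M + int N + 1) \<in> {1..N}"
      by (auto simp: R_B_def H_verts_def)
    then show "(x, y) \<in> R_B K L M N ` {1..N}" by blast
  qed (use assms in \<open>auto simp: R_B_def H_verts_def\<close>)
  ultimately show ?thesis unfolding right_verts_def by blast
qed

lemma top_bottom_verts_iff:
  assumes "K \<le> M + N" and "N \<le> K + L" and "1 \<le> M + N"
  shows "(x, y) \<in> top_bottom_verts K L M N \<longleftrightarrow>
    (x, y) \<in> H_verts K L M N - (left_verts K L M N \<union> right_verts K L M N) \<and>
    (y = int K - 1 \<and> even (x + y) \<or> y = int K - int M - int N \<and> odd (x + y))"
proof -
  have "(x, y) \<in> T_top K ` {1..L} \<longleftrightarrow>
    (x, y) \<in> H_verts K L M N \<and> x \<noteq> y \<and> x \<noteq> 2 * (int K + int L) - y \<and>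
    y = int K - 1 \<and> even (x + y)" (is "?l \<longleftrightarrow> ?r")
  proof
    assume *: ?r
    then obtain k where "x + y = 2 * k" by (blast elim: evenE)
    with * have "(x, y) = T_top K (nat (k - int K + 1))" "nat (k - int K + 1) \<in> {1..L}"
      by (auto simp: T_top_def H_verts_def)
    then show ?l by blast
  qed (use assms in \<open>auto simp: T_top_def H_verts_def\<close>)
  moreover have "(x, y) \<in> B_bot K M N ` {1..K + L - N} \<longleftrightarrow>
    (x, y) \<in> H_verts K L M N \<and> x \<noteq> - y - 1 \<and> x \<noteq> y + 2 * (int M + int L) + 1 \<and>
    y = int K - int M - int N \<and> odd (x + y)" (is "?l \<longleftrightarrow> ?r")
  proof
    assume *: ?r
    then obtain k where "x + y = 2 * k + 1" by (blast elim: oddE)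
    with * have "(x, y) = B_bot K M N (nat (k + 1))" "nat (k + 1) \<in> {1..K + L - N}"
      by (auto simp: B_bot_def H_verts_def Let_def)
    then show ?l by blast
  qed (use assms in \<open>auto simp: B_bot_def H_verts_def Let_def\<close>)
  \<comment> \<open>On each slanted side the parity of \<open>x + y\<close> is constant, so two of
    the four exclusions hold automatically for a vertex of given parity.\<close>
  moreover have "x \<noteq> - y - 1 \<and> x \<noteq> y + 2 * (int M + int L) + 1" if "even (x + y)"
    using that by (auto; presburger)
  moreover have "x \<noteq> y \<and> x \<noteq> 2 * (int K + int L) - y" if "odd (x + y)"
    using that by auto
  ultimately show ?thesis
    unfolding top_bottom_verts_def Un_iff Diff_iff left_verts_iff[OF assms(1,2)] right_verts_iff[OF assms(1,2)]
    by blast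
qed

lemma finite_H_verts: "finite (H_verts K L M N)"
proof (rule finite_subset)
  show "H_verts K L M N \<subseteq> {- 1 - int K .. int M + int N + 2 * (int K + int L + int M)} \<times> {- int M - int N .. int K}"
    by (auto simp: H_verts_def)
qed simp

text \<open>Asymmetry of \<open>A\<close> acts twice: it makes the passage from arcs to edges
  injective, and it forbids loops, so that no arc both enters and leaves \<open>v\<close>.\<close>

lemma degree_eq_in_out:
  assumes "orientation_of f A" and "finite A"
  shows "degree f v = in_deg A v + out_deg A v"
proof -
  have f: "f = (\<lambda>(u, w). {u, w}) ` A" and asym: "\<And>u w. (u, w) \<in> A \<Longrightarrow> (w, u) \<notin> A"
    using assms(1) by (auto simp: orientation_of_def)
  have inj: "inj_on (\<lambda>(u, w). {u, w}) A"
    using asym by (auto simp: inj_on_def doubleton_eq_iff)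
  have "{e \<in> f. v \<in> e} = (\<lambda>(u, w). {u, w}) ` ({a \<in> A. snd a = v} \<union> {a \<in> A. fst a = v})"
    unfolding f by auto
  then have "degree f v = card ({a \<in> A. snd a = v} \<union> {a \<in> A. fst a = v})"
    unfolding degree_def using inj_on_subset[OF inj] by (simp add: card_image Un_subset_iff)
  also have "\<dots> = in_deg A v + out_deg A v"
    unfolding in_deg_def out_deg_def using assms(2) asym by (intro card_Un_disjoint) fastforce+
  finally show ?thesis .
qed

section \<open>Vertex degrees of a fixed oriented configuration\<close>

locale oriented_hexagon =
  fixes K L M N :: nat and f :: "vertex set set" and A :: "(vertex \<times> vertex) set"
    and lT t rT rB b lB :: word
  assumes sizes: "K \<le> M + N" "N \<le> K + L" "1 \<le> M + N"
    and oriented: "oriented_hfpl K L M N f A"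
    and bdry: "boundary K L M N A = (lT, t, rT, rB, b, lB)"
begin

abbreviation "H \<equiv> H_verts K L M N"

text \<open>The indicator is an integer and takes separate coordinates so that degree conditions
  become linear equations between neighbouring indicators and can enter the flows below.\<close>

definition arc :: "int \<Rightarrow> int \<Rightarrow> int \<Rightarrow> int \<Rightarrow> int" where
  "arc x y x' y' = of_bool (((x, y), (x', y')) \<in> A)"

lemma arc_bounds [simp]: "0 \<le> arc x y x' y'" "arc x y x' y' \<le> 1"
  by (auto simp: arc_def)

lemma arc_in_A:
  assumes "(u, v) \<in> A"
  shows "u \<in> H" "v \<in> H" "\<bar>fst u - fst v\<bar> + \<bar>snd u - snd v\<bar> = 1"
proof -
  have "{u, v} \<in> H_edges K L M N"
    using assms oriented unfolding oriented_hfpl_def hfpl_def orientation_of_def by blast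
  then show "u \<in> H" "v \<in> H" "\<bar>fst u - fst v\<bar> + \<bar>snd u - snd v\<bar> = 1"
    by (auto simp: H_edges_def lattice_edges_def doubleton_eq_iff)
qed

lemma arc_outside: "(x, y) \<notin> H \<Longrightarrow> arc x y x' y' = 0" "(x', y') \<notin> H \<Longrightarrow> arc x y x' y' = 0"
  using arc_in_A by (auto simp: arc_def)

lemma arc_asym: "arc x y x' y' + arc x' y' x y \<le> 1"
  using oriented by (auto simp: arc_def oriented_hfpl_def orientation_of_def)

lemma arc_cases:
  assumes "((x, y), (x', y')) \<in> A"
  shows "x' = x + 1 \<and> y' = y \<or> x' = x - 1 \<and> y' = y \<or> x' = x \<and> y' = y + 1 \<or> x' = x \<and> y' = y - 1"
  using arc_in_A(3)[OF assms] by simp presburger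

lemma finite_A: "finite A"
  by (rule finite_subset[of _ "H \<times> H"]) (use arc_in_A in \<open>auto simp: finite_H_verts\<close>)

lemma degree_split: "degree f v = in_deg A v + out_deg A v"
  using degree_eq_in_out finite_A oriented by (auto simp: oriented_hfpl_def)

lemma out_deg_arcs:
  "int (out_deg A (x, y)) = arc x y (x + 1) y + arc x y (x - 1) y + arc x y x (y + 1) + arc x y x (y - 1)"
proof -
  let ?S = "{((x, y), (x + 1, y)), ((x, y), (x - 1, y)), ((x, y), (x, y + 1)), ((x, y), (x, y - 1))}"
  have "{a \<in> A. fst a = (x, y)} = {a \<in> ?S. a \<in> A}"
    using arc_cases by fastforce
  then have "int (out_deg A (x, y)) = (\<Sum>a\<in>?S. of_bool (a \<in> A))"
    by (simp add: out_deg_def Int_def)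
  then show ?thesis by (simp add: arc_def)
qed

lemma in_deg_arcs:
  "int (in_deg A (x, y)) = arc (x + 1) y x y + arc (x - 1) y x y + arc x (y + 1) x y + arc x (y - 1) x y"
proof -
  let ?S = "{((x + 1, y), (x, y)), ((x - 1, y), (x, y)), ((x, y + 1), (x, y)), ((x, y - 1), (x, y))}"
  have "{a \<in> A. snd a = (x, y)} = {a \<in> ?S. a \<in> A}"
    using arc_cases by fastforce
  then have "int (in_deg A (x, y)) = (\<Sum>a\<in>?S. of_bool (a \<in> A))"
    by (simp add: in_deg_def Int_def)
  then show ?thesis by (simp add: arc_def)
qed

lemma left_vert_deg:
  assumes "v \<in> left_verts K L M N"
  shows "in_deg A v = 0" "out_deg A v \<le> 1"
proof -
  show "in_deg A v = 0"
    using oriented assms by (fastforce simp: oriented_hfpl_def in_deg_def card_eq_0_iff)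
  have "degree f v \<in> {0, 1}"
    using oriented assms unfolding oriented_hfpl_def hfpl_def by blast
  then show "out_deg A v \<le> 1" by (auto simp: degree_split)
qed

lemma right_vert_deg:
  assumes "v \<in> right_verts K L M N"
  shows "out_deg A v = 0" "in_deg A v \<le> 1"
proof -
  show "out_deg A v = 0"
    using oriented assms by (fastforce simp: oriented_hfpl_def out_deg_def card_eq_0_iff)
  have "degree f v \<in> {0, 1}"
    using oriented assms unfolding oriented_hfpl_def hfpl_def by blast
  then show "in_deg A v \<le> 1" by (auto simp: degree_split)
qed

lemma top_bottom_deg:
  assumes "v \<in> top_bottom_verts K L M N"
  shows "in_deg A v + out_deg A v = 1"
proof -
  have "degree f v = 1"
    using oriented assms unfolding oriented_hfpl_def hfpl_def by blast
  then show ?thesis by (simp add: degree_split)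
qed

lemma inner_deg:
  assumes "v \<in> H" and "v \<notin> left_verts K L M N \<union> right_verts K L M N \<union> top_bottom_verts K L M N"
  shows "in_deg A v = 1" "out_deg A v = 1"
proof -
  have "degree f v = 2"
    using oriented assms unfolding oriented_hfpl_def hfpl_def by blast
  then show "in_deg A v = 1" "out_deg A v = 1"
    using oriented assms by (auto simp: oriented_hfpl_def)
qed

lemma deg_outside: "v \<notin> H \<Longrightarrow> out_deg A v = 0 \<and> in_deg A v = 0"
  using arc_in_A by (fastforce simp: out_deg_def in_deg_def card_eq_0_iff)

text \<open>This is the matching property: no two arcs share a tail and no two share a head.\<close>

lemma deg_le_1: "out_deg A v \<le> 1 \<and> in_deg A v \<le> 1"
  using deg_outside[of v] inner_deg[of v] left_vert_deg[of v] right_vert_deg[of v] top_bottom_deg[of v]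
  by (cases "v \<in> H"; cases "v \<in> left_verts K L M N"; cases "v \<in> right_verts K L M N";
      cases "v \<in> top_bottom_verts K L M N") auto

lemmas H_iff = H_verts_def[of K L M N]
lemmas left_iff = left_verts_iff[OF sizes(1,2)]
lemmas right_iff = right_verts_iff[OF sizes(1,2)]
lemmas top_bottom_iff = top_bottom_verts_iff[OF sizes]

text \<open>An arc can be missing only at the boundary, and the parity leaves the upper slanted
  sides and the top row. This locates the vertices that a matching misses in the diagonal
  cuts.\<close>

lemma even_vertex_deg:
  assumes "(x, y) \<in> H" and "even (x + y)"
  shows "out_deg A (x, y) = 0 \<Longrightarrow> x + y \<noteq> 2 * (int K + int L) \<Longrightarrow> x = y \<or> y = int K - 1"
    and "in_deg A (x, y) = 0 \<Longrightarrow> x \<noteq> y \<Longrightarrow> x + y = 2 * (int K + int L) \<or> y = int K - 1"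
proof -
  have "x \<noteq> - y - 1" "x \<noteq> y + 2 * (int M + int L) + 1" using assms(2) by auto
  then have "(x, y) \<in> left_verts K L M N \<union> right_verts K L M N \<union> top_bottom_verts K L M N \<Longrightarrow>
      x = y \<or> x + y = 2 * (int K + int L) \<or> y = int K - 1"
    using assms(2) by (auto simp: left_iff right_iff top_bottom_iff)
  with inner_deg[OF assms(1)] show
    "out_deg A (x, y) = 0 \<Longrightarrow> x + y \<noteq> 2 * (int K + int L) \<Longrightarrow> x = y \<or> y = int K - 1"
    "in_deg A (x, y) = 0 \<Longrightarrow> x \<noteq> y \<Longrightarrow> x + y = 2 * (int K + int L) \<or> y = int K - 1"
    by force+
qed

lemma odd_vertex_deg:
  assumes "(x, y) \<in> H" and "odd (x + y)"
  shows "in_deg A (x, y) = 0 \<Longrightarrow> x \<noteq> - y - 1 \<Longrightarrow>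
      x = y + 2 * (int M + int L) + 1 \<or> y = int K - int M - int N"
    and "out_deg A (x, y) = 0 \<Longrightarrow> x \<noteq> y + 2 * (int M + int L) + 1 \<Longrightarrow>
      x = - y - 1 \<or> y = int K - int M - int N"
proof -
  have "x \<noteq> y" "x + y \<noteq> 2 * (int K + int L)" using assms(2) by fastforce+
  then have "(x, y) \<in> left_verts K L M N \<union> right_verts K L M N \<union> top_bottom_verts K L M N \<Longrightarrow>
      x = - y - 1 \<or> x = y + 2 * (int M + int L) + 1 \<or> y = int K - int M - int N"
    using assms(2) by (auto simp: left_iff right_iff top_bottom_iff)
  with inner_deg[OF assms(1)] show
    "in_deg A (x, y) = 0 \<Longrightarrow> x \<noteq> - y - 1 \<Longrightarrow>
      x = y + 2 * (int M + int L) + 1 \<or> y = int K - int M - int N"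
    "out_deg A (x, y) = 0 \<Longrightarrow> x \<noteq> y + 2 * (int M + int L) + 1 \<Longrightarrow>
      x = - y - 1 \<or> y = int K - int M - int N"
    by force+
qed

section \<open>Boundary letters as vertex degrees\<close>

lemma lengths: "length lT = K" "length t = L" "length rT = M" "length rB = N"
  "length b = K + L - N" "length lB = M + N - K"
  using bdry by (auto simp: boundary_def)

lemma eq_of_bool_one: "d \<le> 1 \<Longrightarrow> (d::nat) = of_bool (d = 1)"
  by (cases d) auto

lemma lT_nth: "i < K \<Longrightarrow> out_deg A (int i, int i) = of_bool (lT ! i = 1)"
proof -
  assume "i < K"
  then have "lT ! i = (if out_deg A (L_T (Suc i)) = 1 then 1 else 0)"
    using bdry by (auto simp: boundary_def simp del: upt_Suc)
  then show ?thesis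
    using eq_of_bool_one[of "out_deg A (int i, int i)"] deg_le_1 by (auto simp: L_T_def)
qed

lemma rT_nth: "i < M \<Longrightarrow>
  in_deg A (int K + 2 * int L + int i + 1, int K - 1 - int i) = of_bool (rT ! i = 0)"
proof -
  assume "i < M"
  then have "rT ! i = (if in_deg A (R_T K L (Suc i)) = 1 then 0 else 1)"
    using bdry by (auto simp: boundary_def simp del: upt_Suc)
  then show ?thesis
    using eq_of_bool_one[of "in_deg A (R_T K L (Suc i))"] deg_le_1
    by (auto simp: R_T_def algebra_simps)
qed

lemma rB_nth: "i < N \<Longrightarrow>
  in_deg A (int K + int M - int N + 2 * int L + int i + 1, int K - int M - int N + int i)
    = of_bool (rB ! i = 1)"
proof -
  assume "i < N"
  then have "rB ! i = (if in_deg A (R_B K L M N (Suc i)) = 1 then 1 else 0)"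
    using bdry by (auto simp: boundary_def simp del: upt_Suc)
  then show ?thesis
    using eq_of_bool_one[of "in_deg A (R_B K L M N (Suc i))"] deg_le_1
    by (auto simp: R_B_def algebra_simps)
qed

lemma lB_nth: "i < M + N - K \<Longrightarrow> out_deg A (int i, - int i - 1) = of_bool (lB ! i = 0)"
proof -
  assume "i < M + N - K"
  then have "lB ! i = (if out_deg A (L_B (Suc i)) = 1 then 0 else 1)"
    using bdry by (auto simp: boundary_def simp del: upt_Suc)
  moreover have "L_B (Suc i) = (int i, - int i - 1)" by (simp add: L_B_def)
  ultimately show ?thesis
    using eq_of_bool_one[of "out_deg A (int i, - int i - 1)"] deg_le_1 by auto
qed

text \<open>A top vertex has total degree one, so its letter fixes both degrees. The word
  \<open>t\<close> can thus be read from outgoing arcs as part of \<open>l_T t\<close> and from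
  incoming arcs as part of \<open>t r_T\<close>.\<close>

lemma t_nth:
  assumes "i < L"
  shows "(int K + 1 + 2 * int i, int K - 1) \<in> top_bottom_verts K L M N"
    and "in_deg A (int K + 1 + 2 * int i, int K - 1) = of_bool (t ! i = 0)"
    and "out_deg A (int K + 1 + 2 * int i, int K - 1) = of_bool (t ! i = 1)"
proof -
  have T: "T_top K (Suc i) = (int K + 1 + 2 * int i, int K - 1)"
    by (simp add: T_top_def)
  then show v: "(int K + 1 + 2 * int i, int K - 1) \<in> top_bottom_verts K L M N"
    using assms by (force simp: top_bottom_verts_def simp flip: T)
  have "t ! i = (if in_deg A (T_top K (Suc i)) = 1 then 0 else 1)"
    using bdry assms by (auto simp: boundary_def simp del: upt_Suc)
  then show "in_deg A (int K + 1 + 2 * int i, int K - 1) = of_bool (t ! i = 0)"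
    "out_deg A (int K + 1 + 2 * int i, int K - 1) = of_bool (t ! i = 1)"
    using top_bottom_deg[OF v] unfolding T by auto
qed

lemma b_nth:
  assumes "i < K + L - N"
  shows "(int M + int N - int K + 1 + 2 * int i, int K - int M - int N) \<in> top_bottom_verts K L M N"
    and "in_deg A (int M + int N - int K + 1 + 2 * int i, int K - int M - int N) = of_bool (b ! i = 1)"
    and "out_deg A (int M + int N - int K + 1 + 2 * int i, int K - int M - int N) = of_bool (b ! i = 0)"
proof -
  have B: "B_bot K M N (Suc i) = (int M + int N - int K + 1 + 2 * int i, int K - int M - int N)"
    by (simp add: B_bot_def Let_def)
  then show v: "(int M + int N - int K + 1 + 2 * int i, int K - int M - int N) \<in> top_bottom_verts K L M N"
    using assms by (force simp: top_bottom_verts_def simp flip: B)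
  have "b ! i = (if in_deg A (B_bot K M N (Suc i)) = 1 then 1 else 0)"
    using bdry assms by (auto simp: boundary_def simp del: upt_Suc)
  then show "in_deg A (int M + int N - int K + 1 + 2 * int i, int K - int M - int N) = of_bool (b ! i = 1)"
    "out_deg A (int M + int N - int K + 1 + 2 * int i, int K - int M - int N) = of_bool (b ! i = 0)"
    using top_bottom_deg[OF v] unfolding B by auto
qed

text \<open>
  \<open>sum_top i\<close> and \<open>sum_bot i\<close> carry the letters with list index \<open>i\<close> of \<open>l_T t\<close> and \<open>b r_B\<close> and lie on
  \<open>x + y = 2 i\<close> and \<open>x + y = 2 i + 1\<close>; \<open>diff_top i\<close> and \<open>diff_bot i\<close> carry those of \<open>t r_T\<close> and
  \<open>l_B b\<close> and lie on \<open>x - y = 2 i + 2\<close> and \<open>x - y = 2 i + 1\<close>.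
\<close>

definition sum_top :: "nat \<Rightarrow> vertex" where
  "sum_top i = (2 * int i - min (int i) (int K - 1), min (int i) (int K - 1))"

definition diff_top :: "nat \<Rightarrow> vertex" where
  "diff_top i = (2 * int i + 2 + min (int K - 1) (int K + int L - 1 - int i),
     min (int K - 1) (int K + int L - 1 - int i))"

definition sum_bot :: "nat \<Rightarrow> vertex" where
  "sum_bot i = (2 * int i + 1 - max (int K - int M - int N) (int i - int L - int M),
     max (int K - int M - int N) (int i - int L - int M))"

definition diff_bot :: "nat \<Rightarrow> vertex" where
  "diff_bot i = (2 * int i + 1 + max (int K - int M - int N) (- int i - 1),
     max (int K - int M - int N) (- int i - 1))"

lemma sum_top_deg: "i < K + L \<Longrightarrow> sum_top i \<in> H \<and> out_deg A (sum_top i) = of_bool ((lT @ t) ! i = 1)"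
proof (cases "i < K")
  case True
  with sizes lT_nth[of i] show ?thesis by (auto simp: sum_top_def nth_append lengths H_iff)
next
  case False
  assume i: "i < K + L"
  with False have eq: "sum_top i = (int K + 1 + 2 * int (i - K), int K - 1)" by (auto simp: sum_top_def)
  then have "sum_top i \<in> H" using sizes i False by (auto simp: H_iff)
  with False t_nth[of "i - K"] i eq show ?thesis by (auto simp: nth_append lengths)
qed

lemma diff_top_deg: "i < L + M \<Longrightarrow> diff_top i \<in> H \<and> in_deg A (diff_top i) = of_bool ((t @ rT) ! i = 0)"
proof (cases "i < L")
  case True
  then have eq: "diff_top i = (int K + 1 + 2 * int i, int K - 1)" by (auto simp: diff_top_def)
  then have "diff_top i \<in> H" using sizes True by (auto simp: H_iff)
  with True t_nth[of "i"] eq show ?thesis by (auto simp: nth_append lengths)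
next
  case False
  assume i: "i < L + M"
  with False have eq: "diff_top i = (int K + 2 * int L + int (i - L) + 1, int K - 1 - int (i - L))"
    by (auto simp: diff_top_def)
  then have "diff_top i \<in> H" using sizes i False by (auto simp: H_iff)
  with False rT_nth[of "i - L"] i eq show ?thesis by (auto simp: nth_append lengths)
qed

lemma sum_bot_deg: "i < K + L \<Longrightarrow> sum_bot i \<in> H \<and> in_deg A (sum_bot i) = of_bool ((b @ rB) ! i = 1)"
proof (cases "i < K + L - N")
  case True
  then have eq: "sum_bot i = (int M + int N - int K + 1 + 2 * int i, int K - int M - int N)"
    by (auto simp: sum_bot_def)
  then have "sum_bot i \<in> H" using sizes True by (auto simp: H_iff)
  with True b_nth[of i] eq show ?thesis by (auto simp: nth_append lengths)
next
  case False
  assume i: "i < K + L"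
  let ?j = "i - (K + L - N)"
  from i False sizes have eq: "sum_bot i =
    (int K + int M - int N + 2 * int L + int ?j + 1, int K - int M - int N + int ?j)"
    by (auto simp: sum_bot_def)
  then have "sum_bot i \<in> H" using sizes i False by (auto simp: H_iff)
  with False rB_nth[of ?j] i eq sizes show ?thesis by (auto simp: nth_append lengths)
qed

lemma diff_bot_deg: "i < L + M \<Longrightarrow> diff_bot i \<in> H \<and> out_deg A (diff_bot i) = of_bool ((lB @ b) ! i = 0)"
proof (cases "i < M + N - K")
  case True
  then have eq: "diff_bot i = (int i, - int i - 1)" by (auto simp: diff_bot_def)
  then have "diff_bot i \<in> H" using sizes True by (auto simp: H_iff)
  with True lB_nth[of i] eq show ?thesis by (auto simp: nth_append lengths)
next
  case False
  assume i: "i < L + M"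
  let ?j = "i - (M + N - K)"
  from i False sizes have eq: "diff_bot i = (int M + int N - int K + 1 + 2 * int ?j, int K - int M - int N)"
    by (auto simp: diff_bot_def)
  then have "diff_bot i \<in> H" using sizes i False by (auto simp: H_iff)
  with False b_nth[of ?j] i eq sizes show ?thesis by (auto simp: nth_append lengths)
qed

lemma card_uncovered:
  assumes "S = P ` {i. i < k \<and> w ! i = a}" and "inj P" and "k \<le> length w"
  shows "card S = count_list (take k w) a"
proof -
  have "card S = card {i. i < k \<and> w ! i = a}"
    unfolding assms(1) by (rule card_image) (rule inj_on_subset[OF assms(2)], simp)
  also have "{i. i < k \<and> w ! i = a} = {i. i < length (take k w) \<and> take k w ! i = a}"
    using assms(3) by auto
  finally show ?thesis by (simp add: count_list_card)
qed

subsection \<open>Arcs across a diagonal\<close>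

abbreviation sum_coord :: "vertex \<Rightarrow> int" where "sum_coord v \<equiv> fst v + snd v"
abbreviation diff_coord :: "vertex \<Rightarrow> int" where "diff_coord v \<equiv> fst v - snd v"

lemma inj_diagonals: "inj sum_top" "inj sum_bot" "inj diff_top" "inj diff_bot"
  by (auto simp: inj_on_def sum_top_def sum_bot_def diff_top_def diff_bot_def)

lemma not_covered:
  "v \<notin> fst ` {a \<in> A. P (fst a)} \<longleftrightarrow> \<not> P v \<or> out_deg A v = 0"
  "v \<notin> snd ` {a \<in> A. P (fst a)} \<longleftrightarrow> {a \<in> A. snd a = v \<and> P (fst a)} = {}"
proof -
  show "v \<notin> fst ` {a \<in> A. P (fst a)} \<longleftrightarrow> \<not> P v \<or> out_deg A v = 0"
    using finite_A by (auto simp: out_deg_def card_eq_0_iff image_iff)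
  show "v \<notin> snd ` {a \<in> A. P (fst a)} \<longleftrightarrow> {a \<in> A. snd a = v \<and> P (fst a)} = {}"
    by blast
qed

lemma inj_arcs: "inj_on fst A" "inj_on snd A"
proof -
  have *: "card {a \<in> A. fst a = v} \<le> Suc 0" "card {a \<in> A. snd a = v} \<le> Suc 0" for v
    using deg_le_1[of v] by (simp_all add: out_deg_def in_deg_def)
  have fin: "finite {a \<in> A. P a}" for P using finite_A by simp
  show "inj_on fst A" "inj_on snd A"
    using * unfolding card_le_Suc0_iff_eq[OF fin] by (blast intro: inj_onI)+
qed

lemma arc_parity: "a \<in> A \<Longrightarrow> even (sum_coord (snd a)) \<longleftrightarrow> odd (sum_coord (fst a))"
  using arc_cases[of "fst (fst a)" "snd (fst a)" "fst (snd a)" "snd (snd a)"] by auto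

lemma no_arc_to_left: "a \<in> A \<Longrightarrow> snd a \<notin> left_verts K L M N"
  using oriented by (auto simp: oriented_hfpl_def)

text \<open>The unit shift to the right pairs the two parity classes \<open>S\<close> and
  \<open>T\<close> below the diagonal. \<open>T\<close> omits \<open>x + y = -1\<close>, the lower
  left side, whose vertices have no left neighbour and receive no arc. The vertices missed in
  \<open>S\<close> and \<open>T\<close> carry the zeros among the first \<open>k\<close> letters of
  \<open>l_T t\<close> and \<open>b r_B\<close>; arcs that enter \<open>T\<close> from outside
  \<open>S\<close> step left or down from \<open>x + y = 2 k\<close>.\<close>

lemma sum_cut:
  assumes k: "k \<le> K + L"
  shows "int (count_list (take k (lT @ t)) 0) - int (count_list (take k (b @ rB)) 0)
    = int (card {a \<in> A. even (sum_coord (fst a)) \<and> sum_coord (snd a) = sum_coord (fst a) - 1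
        \<and> sum_coord (fst a) = 2 * int k})"
proof -
  define S where "S = {v \<in> H. even (sum_coord v) \<and> sum_coord v \<le> 2 * int k - 2}"
  define T where "T = {v \<in> H. odd (sum_coord v) \<and> 1 \<le> sum_coord v \<and> sum_coord v \<le> 2 * int k - 1}"
  define M1 where "M1 = {a \<in> A. even (sum_coord (fst a))}"
  have bij: "bij_betw (\<lambda>(x, y). (x + 1, y)) S T"
  proof (rule bij_betw_byWitness[where f' = "\<lambda>(x, y). (x - 1, y)"])
    show "(\<lambda>(x, y). (x + 1, y)) ` S \<subseteq> T"
    proof safe
      fix x y assume xy: "(x, y) \<in> S"
      then have xyH: "(x, y) \<in> H" and "even (x - y)" "even (x + y)" and le: "x + y \<le> 2 * int k - 2"
        by (auto simp: S_def)
      from xyH have "x - y \<le> 2 * (int M + int L) + 1" "- 1 \<le> x + y" by (auto simp: H_iff)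
      with \<open>even (x - y)\<close> \<open>even (x + y)\<close> have "x - y \<le> 2 * (int M + int L)" "0 \<le> x + y"
        by presburger+
      with xyH le k have "(x + 1, y) \<in> H" by (auto simp: H_iff)
      with le \<open>even (x + y)\<close> \<open>0 \<le> x + y\<close> show "(x + 1, y) \<in> T" by (simp add: T_def)
    qed
    show "(\<lambda>(x, y). (x - 1, y)) ` T \<subseteq> S"
    proof safe
      fix x y assume xy: "(x, y) \<in> T"
      then have xyH: "(x, y) \<in> H" and "odd (x - y)" "odd (x + y)" and le: "1 \<le> x + y" "x + y \<le> 2 * int k - 1"
        by (auto simp: T_def)
      from xyH have "0 \<le> x - y" by (auto simp: H_iff)
      with \<open>odd (x - y)\<close> have "1 \<le> x - y" by presburger
      with xyH le k have "(x - 1, y) \<in> H" by (auto simp: H_iff)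
      with le \<open>odd (x + y)\<close> show "(x - 1, y) \<in> S" by (simp add: S_def)
    qed
  qed auto
  have closed: "snd a \<in> T" if "a \<in> M1" "fst a \<in> S" for a
  proof -
    obtain x y x' y' where a: "a = ((x, y), (x', y'))" by (metis prod.collapse)
    have "x' + y' \<noteq> - 1"
    proof
      assume "x' + y' = - 1"
      then have "(x', y') \<in> left_verts K L M N"
        using arc_in_A(2)[of "(x, y)" "(x', y')"] that a by (auto simp: M1_def left_iff)
      then show False
        using no_arc_to_left[of a] that(1) a by (simp add: M1_def)
    qed
    moreover have "x' + y' \<ge> - 1" "(x', y') \<in> H"
      using arc_in_A(2)[of "(x, y)" "(x', y')"] that(1) a by (auto simp: M1_def H_iff)
    moreover have "odd (x' + y')" using arc_parity[of a] that a by (auto simp: M1_def)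
    moreover have "x' + y' \<le> 2 * int k - 1"
      using arc_cases[of x y x' y'] that a by (auto simp: M1_def S_def)
    ultimately have "1 \<le> x' + y'" by presburger
    with \<open>(x', y') \<in> H\<close> \<open>odd (x' + y')\<close> \<open>x' + y' \<le> 2 * int k - 1\<close> show ?thesis
      using a by (simp add: T_def)
  qed
  have out0: "v \<notin> fst ` M1 \<longleftrightarrow> out_deg A v = 0" if "v \<in> S" for v
    using not_covered(1)[of v "\<lambda>v. even (sum_coord v)"] that by (simp add: S_def M1_def)
  have US: "{v \<in> S. v \<notin> fst ` M1} = sum_top ` {i. i < k \<and> (lT @ t) ! i = 0}"
  proof (intro equalityI subsetI)
    fix v assume v: "v \<in> {v \<in> S. v \<notin> fst ` M1}"
    obtain x y where xy: "v = (x, y)" by (cases v)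
    from v have "v \<in> S" "out_deg A v = 0" using out0 by blast+
    then have "(x, y) \<in> H" "even (x + y)" "x = y \<or> y = int K - 1" "x + y \<le> 2 * int k - 2"
      using even_vertex_deg(1)[of x y] k xy by (auto simp: S_def)
    moreover from this obtain j where "x + y = 2 * j" by (blast elim: evenE)
    ultimately have "v = sum_top (nat j)" "nat j < k"
      using xy k by (auto simp: sum_top_def H_iff)
    with sum_top_deg[of "nat j"] k \<open>out_deg A v = 0\<close> bit_not_one_iff
    show "v \<in> sum_top ` {i. i < k \<and> (lT @ t) ! i = 0}" by auto
  next
    fix v assume "v \<in> sum_top ` {i. i < k \<and> (lT @ t) ! i = 0}"
    then obtain i where i: "i < k" "(lT @ t) ! i = 0" "v = sum_top i" by auto
    with sum_top_deg[of i] k have "v \<in> H" "out_deg A v = 0" by auto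
    with i have "v \<in> S" by (auto simp: S_def sum_top_def)
    with out0 \<open>out_deg A v = 0\<close> show "v \<in> {v \<in> S. v \<notin> fst ` M1}" by auto
  qed
  have in0: "v \<notin> snd ` M1 \<longleftrightarrow> in_deg A v = 0" if "v \<in> T" for v
  proof -
    have "{a \<in> A. snd a = v} = {a \<in> A. snd a = v \<and> even (sum_coord (fst a))}"
      using that arc_parity by (auto simp: T_def)
    then show ?thesis
      using not_covered(2)[of v "\<lambda>v. even (sum_coord v)"] finite_A by (simp add: M1_def in_deg_def)
  qed
  have UT: "{v \<in> T. v \<notin> snd ` M1} = sum_bot ` {i. i < k \<and> (b @ rB) ! i = 0}"
  proof (intro equalityI subsetI)
    fix v assume v: "v \<in> {v \<in> T. v \<notin> snd ` M1}"
    obtain x y where xy: "v = (x, y)" by (cases v)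
    from v have "v \<in> T" "in_deg A v = 0" using in0 by blast+
    then have "(x, y) \<in> H" "odd (x + y)" "x = y + 2 * (int M + int L) + 1 \<or> y = int K - int M - int N"
        "1 \<le> x + y" "x + y \<le> 2 * int k - 1"
      using odd_vertex_deg(1)[of x y] k xy by (auto simp: T_def)
    moreover from this obtain j where "x + y = 2 * j + 1" by (blast elim: oddE)
    ultimately have "v = sum_bot (nat j)" "nat j < k"
      using xy k by (auto simp: sum_bot_def H_iff)
    with sum_bot_deg[of "nat j"] k \<open>in_deg A v = 0\<close> bit_not_one_iff
    show "v \<in> sum_bot ` {i. i < k \<and> (b @ rB) ! i = 0}" by auto
  next
    fix v assume "v \<in> sum_bot ` {i. i < k \<and> (b @ rB) ! i = 0}"
    then obtain i where i: "i < k" "(b @ rB) ! i = 0" "v = sum_bot i" by auto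
    with sum_bot_deg[of i] k have "v \<in> H" "in_deg A v = 0" by auto
    with i have "v \<in> T" by (auto simp: T_def sum_bot_def)
    with in0 \<open>in_deg A v = 0\<close> show "v \<in> {v \<in> T. v \<notin> snd ` M1}" by auto
  qed
  have "{a \<in> M1. snd a \<in> T \<and> fst a \<notin> S} =
    {a \<in> A. even (sum_coord (fst a)) \<and> sum_coord (snd a) = sum_coord (fst a) - 1
        \<and> sum_coord (fst a) = 2 * int k}"  (is "?l = ?r")
  proof (intro equalityI subsetI)
    fix a assume a: "a \<in> ?l"
    obtain x y x' y' where xy: "a = ((x, y), (x', y'))" by (metis prod.collapse)
    from a xy have aA: "((x, y), (x', y')) \<in> A" and "(x, y) \<in> H" and ev: "even (x + y)"
      using arc_in_A by (auto simp: M1_def)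
    with a xy have "x + y > 2 * int k - 2" "x' + y' \<le> 2 * int k - 1"
      by (auto simp: S_def T_def)
    moreover from ev obtain j where "x + y = 2 * j" by (blast elim: evenE)
    moreover have "x' + y' \<ge> x + y - 1" using arc_cases[OF aA] by auto
    ultimately have "x + y = 2 * int k" "x' + y' = x + y - 1"
      by presburger+
    with xy aA ev show "a \<in> ?r" by (simp del: even_add)
  next
    fix a assume a: "a \<in> ?r"
    then have aM: "a \<in> M1" by (auto simp: M1_def)
    \<comment> \<open>For \<open>k = 0\<close> the set \<open>T\<close> is empty, so no arc may be
      counted on the right: it would lead from \<open>x + y = 0\<close> to the lower left side,
      which no arc enters.\<close>
    have "\<not> (k = 0)"
    proof
      assume "k = 0"
      then have "snd a \<in> left_verts K L M N"
        using a arc_in_A(2)[of "fst a" "snd a"] left_iff[of "fst (snd a)" "snd (snd a)"] by auto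
      then show False
        using no_arc_to_left[of a] a by simp
    qed
    moreover have "snd a \<in> H" using a arc_in_A(2)[of "fst a" "snd a"] by auto
    moreover have "odd (sum_coord (snd a))" using a arc_parity[of a] by blast
    ultimately have "snd a \<in> T" "fst a \<notin> S" using a by (simp_all add: T_def S_def del: even_add)
    with aM show "a \<in> ?l" by simp
  qed
  moreover have "int (card {v \<in> S. v \<notin> fst ` M1}) - int (card {v \<in> T. v \<notin> snd ` M1})
      = int (card {a \<in> M1. snd a \<in> T \<and> fst a \<notin> S})"
  proof (rule unmatched_difference[OF _ _ _ _ bij closed])
    show "finite S" using finite_H_verts by (simp add: S_def)
    show "finite M1" using finite_A by (simp add: M1_def)
    show "inj_on fst M1" "inj_on snd M1"
      using inj_arcs by (auto simp: M1_def intro: inj_on_subset)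
  qed
  ultimately show ?thesis
    using card_uncovered[OF US inj_diagonals(1)] card_uncovered[OF UT inj_diagonals(2)] k sizes(2)
    by (simp add: lengths)
qed

text \<open>The counterpart of \<open>sum_cut\<close> for the other diagonals, with the parities
  exchanged. \<open>T\<close> starts at \<open>x - y = 2\<close>, since \<open>x - y = 0\<close> is
  the upper left side, which no arc enters. The missed vertices now carry ones: an absent arc out of
  a vertex of \<open>l_B b\<close>, or into a vertex of \<open>t r_T\<close>, encodes the letter
  1.\<close>

lemma diff_cut:
  assumes k: "k \<le> L + M"
  shows "int (count_list (take k (lB @ b)) 1) - int (count_list (take k (t @ rT)) 1)
    = int (card {a \<in> A. odd (sum_coord (fst a)) \<and> diff_coord (snd a) = diff_coord (fst a) - 1
        \<and> diff_coord (fst a) = 2 * int k + 1})"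
proof -
  define S where "S = {v \<in> H. odd (sum_coord v) \<and> diff_coord v \<le> 2 * int k - 1}"
  define T where "T = {v \<in> H. even (sum_coord v) \<and> 2 \<le> diff_coord v \<and> diff_coord v \<le> 2 * int k}"
  define M2 where "M2 = {a \<in> A. odd (sum_coord (fst a))}"
  have bij: "bij_betw (\<lambda>(x, y). (x + 1, y)) S T"
  proof (rule bij_betw_byWitness[where f' = "\<lambda>(x, y). (x - 1, y)"])
    show "(\<lambda>(x, y). (x + 1, y)) ` S \<subseteq> T"
    proof safe
      fix x y assume xy: "(x, y) \<in> S"
      then have xyH: "(x, y) \<in> H" and "odd (x - y)" "odd (x + y)" and le: "x - y \<le> 2 * int k - 1"
        by (auto simp: S_def)
      from xyH have "x + y \<le> 2 * (int K + int L)" "0 \<le> x - y" by (auto simp: H_iff)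
      with \<open>odd (x - y)\<close> \<open>odd (x + y)\<close> have "x + y \<le> 2 * (int K + int L) - 1" "1 \<le> x - y"
        by presburger+
      with xyH le k have "(x + 1, y) \<in> H" by (auto simp: H_iff)
      with le \<open>odd (x + y)\<close> \<open>1 \<le> x - y\<close> show "(x + 1, y) \<in> T" by (simp add: T_def)
    qed
    show "(\<lambda>(x, y). (x - 1, y)) ` T \<subseteq> S"
    proof safe
      fix x y assume xy: "(x, y) \<in> T"
      then have xyH: "(x, y) \<in> H" and "even (x + y)" and le: "2 \<le> x - y" "x - y \<le> 2 * int k"
        by (auto simp: T_def)
      from xyH have "- 1 \<le> x + y" by (auto simp: H_iff)
      with \<open>even (x + y)\<close> have "0 \<le> x + y" by presburger
      with xyH le k have "(x - 1, y) \<in> H" by (auto simp: H_iff)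
      with le \<open>even (x + y)\<close> show "(x - 1, y) \<in> S" by (simp add: S_def)
    qed
  qed auto
  have closed: "snd a \<in> T" if "a \<in> M2" "fst a \<in> S" for a
  proof -
    obtain x y x' y' where a: "a = ((x, y), (x', y'))" by (metis prod.collapse)
    have "x' - y' \<noteq> 0"
    proof
      assume "x' - y' = 0"
      then have "(x', y') \<in> left_verts K L M N"
        using arc_in_A(2)[of "(x, y)" "(x', y')"] that a by (auto simp: M2_def left_iff)
      then show False
        using no_arc_to_left[of a] that(1) a by (simp add: M2_def)
    qed
    moreover have "x' - y' \<ge> 0" "(x', y') \<in> H"
      using arc_in_A(2)[of "(x, y)" "(x', y')"] that(1) a by (auto simp: M2_def H_iff)
    moreover have "even (x' + y')" using arc_parity[of a] that a by (auto simp: M2_def)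
    moreover from this have "even (x' - y')" by simp
    moreover have "x' - y' \<le> 2 * int k"
      using arc_cases[of x y x' y'] that a by (auto simp: M2_def S_def)
    ultimately have "2 \<le> x' - y'" by presburger
    with \<open>(x', y') \<in> H\<close> \<open>even (x' + y')\<close> \<open>x' - y' \<le> 2 * int k\<close> show ?thesis
      using a by (simp add: T_def)
  qed
  have out0: "v \<notin> fst ` M2 \<longleftrightarrow> out_deg A v = 0" if "v \<in> S" for v
    using not_covered(1)[of v "\<lambda>v. odd (sum_coord v)"] that by (simp add: S_def M2_def)
  have US: "{v \<in> S. v \<notin> fst ` M2} = diff_bot ` {i. i < k \<and> (lB @ b) ! i = 1}"
  proof (intro equalityI subsetI)
    fix v assume v: "v \<in> {v \<in> S. v \<notin> fst ` M2}"
    obtain x y where xy: "v = (x, y)" by (cases v)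
    from v have "v \<in> S" "out_deg A v = 0" using out0 by blast+
    then have "(x, y) \<in> H" "odd (x - y)" "x = - y - 1 \<or> y = int K - int M - int N" "x - y \<le> 2 * int k - 1"
      using odd_vertex_deg(2)[of x y] k xy by (auto simp: S_def)
    moreover from this obtain j where "x - y = 2 * j + 1" by (blast elim: oddE)
    ultimately have "v = diff_bot (nat j)" "nat j < k"
      using xy k by (auto simp: diff_bot_def H_iff)
    with diff_bot_deg[of "nat j"] k \<open>out_deg A v = 0\<close> bit_not_one_iff
    show "v \<in> diff_bot ` {i. i < k \<and> (lB @ b) ! i = 1}" by auto
  next
    fix v assume "v \<in> diff_bot ` {i. i < k \<and> (lB @ b) ! i = 1}"
    then obtain i where i: "i < k" "(lB @ b) ! i = 1" "v = diff_bot i" by auto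
    with diff_bot_deg[of i] k have "v \<in> H" "out_deg A v = 0" by auto
    with i have "v \<in> S" by (auto simp: S_def diff_bot_def)
    with out0 \<open>out_deg A v = 0\<close> show "v \<in> {v \<in> S. v \<notin> fst ` M2}" by auto
  qed
  have in0: "v \<notin> snd ` M2 \<longleftrightarrow> in_deg A v = 0" if "v \<in> T" for v
  proof -
    have "{a \<in> A. snd a = v} = {a \<in> A. snd a = v \<and> odd (sum_coord (fst a))}"
      using that arc_parity by (auto simp: T_def)
    then show ?thesis
      using not_covered(2)[of v "\<lambda>v. odd (sum_coord v)"] finite_A by (simp add: M2_def in_deg_def)
  qed
  have UT: "{v \<in> T. v \<notin> snd ` M2} = diff_top ` {i. i < k \<and> (t @ rT) ! i = 1}"
  proof (intro equalityI subsetI)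
    fix v assume v: "v \<in> {v \<in> T. v \<notin> snd ` M2}"
    obtain x y where xy: "v = (x, y)" by (cases v)
    from v have "v \<in> T" "in_deg A v = 0" using in0 by blast+
    then have "(x, y) \<in> H" "even (x - y)" "x + y = 2 * (int K + int L) \<or> y = int K - 1"
        "2 \<le> x - y" "x - y \<le> 2 * int k"
      using even_vertex_deg(2)[of x y] k xy by (auto simp: T_def)
    moreover from this obtain j where "x - y = 2 * j" by (blast elim: evenE)
    ultimately have "v = diff_top (nat (j - 1))" "nat (j - 1) < k"
      using xy k by (auto simp: diff_top_def H_iff)
    with diff_top_deg[of "nat (j - 1)"] k \<open>in_deg A v = 0\<close> bit_not_one_iff
    show "v \<in> diff_top ` {i. i < k \<and> (t @ rT) ! i = 1}" by auto
  next
    fix v assume "v \<in> diff_top ` {i. i < k \<and> (t @ rT) ! i = 1}"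
    then obtain i where i: "i < k" "(t @ rT) ! i = 1" "v = diff_top i" by auto
    with diff_top_deg[of i] k have "v \<in> H" "in_deg A v = 0" by auto
    with i have "v \<in> T" by (auto simp: T_def diff_top_def)
    with in0 \<open>in_deg A v = 0\<close> show "v \<in> {v \<in> T. v \<notin> snd ` M2}" by auto
  qed
  have "{a \<in> M2. snd a \<in> T \<and> fst a \<notin> S} =
    {a \<in> A. odd (sum_coord (fst a)) \<and> diff_coord (snd a) = diff_coord (fst a) - 1
        \<and> diff_coord (fst a) = 2 * int k + 1}"  (is "?l = ?r")
  proof (intro equalityI subsetI)
    fix a assume a: "a \<in> ?l"
    obtain x y x' y' where xy: "a = ((x, y), (x', y'))" by (metis prod.collapse)
    from a xy have aA: "((x, y), (x', y')) \<in> A" and "(x, y) \<in> H" and ev: "odd (x - y)" "odd (x + y)"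
      using arc_in_A by (auto simp: M2_def)
    with a xy have "x - y > 2 * int k - 1" "x' - y' \<le> 2 * int k"
      by (auto simp: S_def T_def)
    moreover from ev obtain j where "x - y = 2 * j + 1" by (blast elim: oddE)
    moreover have "x' - y' \<ge> x - y - 1" using arc_cases[OF aA] by auto
    ultimately have "x - y = 2 * int k + 1" "x' - y' = x - y - 1"
      by presburger+
    with xy aA ev show "a \<in> ?r" by simp
  next
    fix a assume a: "a \<in> ?r"
    then have aM: "a \<in> M2" by (auto simp: M2_def)
    have "\<not> (k = 0)"
    proof
      assume "k = 0"
      then have "snd a \<in> left_verts K L M N"
        using a arc_in_A(2)[of "fst a" "snd a"] left_iff[of "fst (snd a)" "snd (snd a)"] by auto
      then show False
        using no_arc_to_left[of a] a by simp
    qed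
    moreover have "snd a \<in> H" using a arc_in_A(2)[of "fst a" "snd a"] by auto
    moreover have "even (sum_coord (snd a))" using a arc_parity[of a] by blast
    ultimately have "snd a \<in> T" "fst a \<notin> S" using a by (simp_all add: T_def S_def del: even_add)
    with aM show "a \<in> ?l" by simp
  qed
  moreover have "int (card {v \<in> S. v \<notin> fst ` M2}) - int (card {v \<in> T. v \<notin> snd ` M2})
      = int (card {a \<in> M2. snd a \<in> T \<and> fst a \<notin> S})"
  proof (rule unmatched_difference[OF _ _ _ _ bij closed])
    show "finite S" using finite_H_verts by (simp add: S_def)
    show "finite M2" using finite_A by (simp add: M2_def)
    show "inj_on fst M2" "inj_on snd M2"
      using inj_arcs by (auto simp: M2_def intro: inj_on_subset)
  qed
  ultimately show ?thesis
    using card_uncovered[OF US inj_diagonals(4)] card_uncovered[OF UT inj_diagonals(3)] k sizes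
    by (simp add: lengths)
qed

text \<open>At the last cut, \<open>k = K + L\<close> or \<open>k = L + M\<close>, a counted arc
  would have to start at a right boundary vertex, so the totals agree. Nonnegativity of each cut
  gives dominance, and summation over the cuts with \<open>inv_number_diff\<close> gives the arc
  counts.\<close>

lemma count_shifts:
  "int (inv_number (b @ rB)) - int (inv_number (lT @ t))
    = int (card {a \<in> A. even (sum_coord (fst a)) \<and> sum_coord (snd a) = sum_coord (fst a) - 1})"
  "int (inv_number (lB @ b)) - int (inv_number (t @ rT))
    = int (card {a \<in> A. odd (sum_coord (fst a)) \<and> diff_coord (snd a) = diff_coord (fst a) - 1})"
  "word_le (lT @ t) (b @ rB)" "word_le (t @ rT) (lB @ b)"
  "count_list (lT @ t) 0 = count_list (b @ rB) 0" "count_list (t @ rT) 0 = count_list (lB @ b) 0"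
proof -
  let ?D1 = "{a \<in> A. even (sum_coord (fst a)) \<and> sum_coord (snd a) = sum_coord (fst a) - 1}"
  let ?D2 = "{a \<in> A. odd (sum_coord (fst a)) \<and> diff_coord (snd a) = diff_coord (fst a) - 1}"
  have len: "length (lT @ t) = K + L" "length (b @ rB) = K + L"
    "length (t @ rT) = L + M" "length (lB @ b) = L + M"
    using sizes by (auto simp: lengths)
  have bits: "count_list (take k w) 0 + count_list (take k w) 1 = k" if "k \<le> length w"
    for k and w :: word
    using count_list_bit_length[of "take k w"] that by simp
  have dec1: "count_list (take k (b @ rB)) 0 \<le> count_list (take k (lT @ t)) 0" if "k \<le> K + L" for k
    using sum_cut[OF that] by linarith
  have dec2: "count_list (take k (lB @ b)) 0 \<le> count_list (take k (t @ rT)) 0" if "k \<le> L + M" for k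
    using diff_cut[OF that] bits[of k "lB @ b"] bits[of k "t @ rT"] that len by linarith
  have no_right: "fst a \<notin> right_verts K L M N" if "a \<in> A" for a
    using oriented that by (auto simp: oriented_hfpl_def)
  have no: False if "a \<in> A" "sum_coord (fst a) = 2 * int (K + L)" for a
    using no_right[OF that(1)] arc_in_A(1)[of "fst a" "snd a"] that
      right_iff[of "fst (fst a)" "snd (fst a)"] by auto
  have "card {a \<in> A. even (sum_coord (fst a)) \<and> sum_coord (snd a) = sum_coord (fst a) - 1
      \<and> sum_coord (fst a) = 2 * int (K + L)} = 0"
    unfolding card_eq_0_iff using no by blast
  with sum_cut[OF order_refl] have
    "count_list (take (K + L) (lT @ t)) 0 = count_list (take (K + L) (b @ rB)) 0"
    by linarith
  then show z1: "count_list (lT @ t) 0 = count_list (b @ rB) 0"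
    unfolding take_all[OF eq_refl[OF len(1)]] take_all[OF eq_refl[OF len(2)]] .
  have no': False if "a \<in> A" "diff_coord (fst a) = 2 * int (L + M) + 1" for a
    using no_right[OF that(1)] arc_in_A(1)[of "fst a" "snd a"] that
      right_iff[of "fst (fst a)" "snd (fst a)"] by auto
  have "card {a \<in> A. odd (sum_coord (fst a)) \<and> diff_coord (snd a) = diff_coord (fst a) - 1
      \<and> diff_coord (fst a) = 2 * int (L + M) + 1} = 0"
    unfolding card_eq_0_iff using no' by blast
  with diff_cut[OF order_refl] have
    "count_list (take (L + M) (lB @ b)) 1 = count_list (take (L + M) (t @ rT)) 1"
    by linarith
  then have "count_list (lB @ b) 1 = count_list (t @ rT) 1"
    unfolding take_all[OF eq_refl[OF len(3)]] take_all[OF eq_refl[OF len(4)]] .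
  then show z2: "count_list (t @ rT) 0 = count_list (lB @ b) 0"
    using count_list_bit_length[of "t @ rT"] count_list_bit_length[of "lB @ b"] len by linarith
  show "word_le (lT @ t) (b @ rB)" "word_le (t @ rT) (lB @ b)"
    using word_leI[of "lT @ t" "b @ rB"] word_leI[of "t @ rT" "lB @ b"] dec1 dec2 z1 z2 len by simp_all
  have group: "card S = (\<Sum>k\<le>n. card {a \<in> S. \<phi> a = k})" if "finite S" "\<phi> ` S \<subseteq> {..n}"
    for S :: "'c set" and \<phi> :: "'c \<Rightarrow> nat" and n
    using sum.group[OF that(1) finite_atMost that(2), of "\<lambda>_. 1::nat"] by simp
  have H_of: "fst a \<in> H" if "a \<in> A" for a
    using arc_in_A(1)[of "fst a" "snd a"] that by simp
  have "card ?D1 = (\<Sum>k\<le>K + L. card {a \<in> ?D1. nat (sum_coord (fst a) div 2) = k})"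
  proof (rule group)
    have "sum_coord (fst a) \<le> 2 * int (K + L)" if "a \<in> A" for a
      using H_of[OF that] by (auto simp: H_iff split: prod.splits)
    then have "nat (sum_coord (fst a) div 2) \<le> K + L" if "a \<in> A" for a
      using that by fastforce
    then show "(\<lambda>a. nat (sum_coord (fst a) div 2)) ` ?D1 \<subseteq> {..K + L}" by auto
  qed (use finite_A in simp)
  also have "\<dots> = (\<Sum>k\<le>K + L. card {a \<in> A. even (sum_coord (fst a))
      \<and> sum_coord (snd a) = sum_coord (fst a) - 1 \<and> sum_coord (fst a) = 2 * int k})"
  proof (intro sum.cong refl arg_cong[of _ _ card] Collect_cong)
    fix k :: nat and a :: "vertex \<times> vertex"
    \<comment> \<open>The hexagon guarantees only \<open>-1 <= s\<close>. Parity excludes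
      \<open>s = -1\<close>, which \<open>nat\<close> would merge with \<open>k = 0\<close>.\<close>
    have "nat (s div 2) = k \<longleftrightarrow> s = 2 * int k" if "even s" "- 1 \<le> s" for s :: int
    proof -
      from that have "0 \<le> s" by presburger
      with that(1) show ?thesis by (auto elim: evenE)
    qed
    moreover have "- 1 \<le> sum_coord (fst a)" if "a \<in> A"
      using H_of[OF that] by (auto simp: H_iff split: prod.splits)
    ultimately show "a \<in> ?D1 \<and> nat (sum_coord (fst a) div 2) = k \<longleftrightarrow> a \<in> A \<and> even (sum_coord (fst a))
      \<and> sum_coord (snd a) = sum_coord (fst a) - 1 \<and> sum_coord (fst a) = 2 * int k"
      by blast
  qed
  finally have c1: "card ?D1 = \<dots>" .
  have "card ?D2 = (\<Sum>k\<le>L + M. card {a \<in> ?D2. nat (diff_coord (fst a) div 2) = k})"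
  proof (rule group)
    have "diff_coord (fst a) \<le> 2 * int (L + M) + 1" if "a \<in> A" for a
      using H_of[OF that] by (auto simp: H_iff split: prod.splits)
    then have "nat (diff_coord (fst a) div 2) \<le> L + M" if "a \<in> A" for a
      using that by fastforce
    then show "(\<lambda>a. nat (diff_coord (fst a) div 2)) ` ?D2 \<subseteq> {..L + M}" by auto
  qed (use finite_A in simp)
  also have "\<dots> = (\<Sum>k\<le>L + M. card {a \<in> A. odd (sum_coord (fst a))
      \<and> diff_coord (snd a) = diff_coord (fst a) - 1 \<and> diff_coord (fst a) = 2 * int k + 1})"
  proof (intro sum.cong refl arg_cong[of _ _ card] Collect_cong)
    fix k :: nat and a :: "vertex \<times> vertex"
    have "nat (s div 2) = k \<longleftrightarrow> s = 2 * int k + 1" if "odd s" "0 \<le> s" for s :: int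
      using that by (auto elim!: oddE)
    moreover have "odd (sum_coord (fst a)) \<longleftrightarrow> odd (diff_coord (fst a))" by simp
    moreover have "0 \<le> diff_coord (fst a)" if "a \<in> A"
      using H_of[OF that] by (auto simp: H_iff split: prod.splits)
    ultimately show "a \<in> ?D2 \<and> nat (diff_coord (fst a) div 2) = k \<longleftrightarrow> a \<in> A \<and> odd (sum_coord (fst a))
      \<and> diff_coord (snd a) = diff_coord (fst a) - 1 \<and> diff_coord (fst a) = 2 * int k + 1"
      by blast
  qed
  finally have c2: "card ?D2 = \<dots>" .
  show "int (inv_number (b @ rB)) - int (inv_number (lT @ t)) = int (card ?D1)"
    unfolding c1 of_nat_sum inv_number_diff[of "lT @ t" "b @ rB", OF trans[OF len(1) len(2)[symmetric]] z1] len
    by (rule sum.cong[OF refl], rule sum_cut) simp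
  have cmp: "int (count_list (take k (t @ rT)) 0) - int (count_list (take k (lB @ b)) 0)
     = int (count_list (take k (lB @ b)) 1) - int (count_list (take k (t @ rT)) 1)" if "k \<le> L + M" for k
    using bits[of k "lB @ b"] bits[of k "t @ rT"] that len by linarith
  show "int (inv_number (lB @ b)) - int (inv_number (t @ rT)) = int (card ?D2)"
    unfolding c2 of_nat_sum inv_number_diff[of "t @ rT" "lB @ b", OF trans[OF len(3) len(4)[symmetric]] z2] len
    by (rule sum.cong[OF refl]) (use cmp diff_cut in simp)
qed

subsection \<open>The two flows\<close>

text \<open>
  The first flow is the matching by arcs out of vertices with even coordinate sum, minus the
  matching of these vertices with their right neighbours; the second is the matching by arcs into
  these vertices, minus the matching with their left neighbours. Both point away from the vertices
  with even coordinate sum. A path ending on the left or right boundary is continued horizontally to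
  infinity, one ending on the top or bottom row leaves vertically (\<open>exitT\<close>, \<open>exitB\<close>), so that both
  flows are conserved at all vertices of the strip.
\<close>

definition exitT :: "int \<Rightarrow> int \<Rightarrow> nat \<Rightarrow> int" where
  "exitT x y d = of_bool (y = int K \<and> odd (x + y) \<and> (x, y - 1) \<in> top_bottom_verts K L M N \<and> d = 0)"

definition exitB :: "int \<Rightarrow> int \<Rightarrow> nat \<Rightarrow> int" where
  "exitB x y d = of_bool (y = int K - int M - int N \<and> odd (x + y) \<and>
     (x, y) \<in> top_bottom_verts K L M N \<and> d = 0)"

definition v1 :: "int \<Rightarrow> int \<Rightarrow> int" where
  "v1 x y = (if even (x + y) then - arc x y x (y - 1)
     else arc x (y - 1) x y + exitT x y (out_deg A (x, y - 1)) + exitB x y (in_deg A (x, y)))"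

definition v2 :: "int \<Rightarrow> int \<Rightarrow> int" where
  "v2 x y = (if even (x + y) then - arc x (y - 1) x y
     else arc x y x (y - 1) + exitT x y (in_deg A (x, y - 1)) + exitB x y (out_deg A (x, y)))"

definition row_left :: "int \<Rightarrow> int" where
  "row_left y = max y (- y - 1)"

definition row_right :: "int \<Rightarrow> int" where
  "row_right y = min (2 * (int K + int L) - y) (y + 2 * (int M + int L) + 1)"

definition g1 :: "int \<Rightarrow> int \<Rightarrow> int" where
  "g1 x y = (if x < row_left y then (if 0 \<le> y then int (out_deg A (row_left y, y)) - 1 else 0)
     else if row_right y \<le> x then (if y < int K - int M then int (in_deg A (row_right y, y)) - 1 else 0)
     else if even (x + y) then arc x y (x + 1) y - 1 else - arc (x + 1) y x y)"

definition g2 :: "int \<Rightarrow> int \<Rightarrow> int" where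
  "g2 x y = (if x < row_left y then (if 0 \<le> y then 0 else 1 - int (out_deg A (row_left y, y)))
     else if row_right y \<le> x then (if y < int K - int M then 0 else 1 - int (in_deg A (row_right y, y)))
     else if even (x + y) then arc (x + 1) y x y else 1 - arc x y (x + 1) y)"

abbreviation "rows \<equiv> {int K - int M - int N..<int K}"

lemma H_rows: "(x, y) \<in> H \<longleftrightarrow> y \<in> rows \<and> row_left y \<le> x \<and> x \<le> row_right y"
  by (auto simp: H_iff row_left_def row_right_def)

lemma row_left_less_right: "y \<in> rows \<Longrightarrow> row_left y < row_right y"
  using sizes by (auto simp: row_left_def row_right_def)

text \<open>The left side changes slope between \<open>y = -1\<close> and \<open>y = 0\<close>, the
  right side between \<open>y = K - M - 1\<close> and \<open>y = K - M\<close>; hence four slanted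
  cases, in each of which the parity and one vanishing degree are known.\<close>

lemma vertex_cases:
  assumes "(x, y) \<in> H"
  obtains (LT) "x = row_left y" "0 \<le> y" "x = y" "even (x + y)" "in_deg A (x, y) = 0"
      "(x, y) \<notin> top_bottom_verts K L M N"
  | (LB) "x = row_left y" "y < 0" "odd (x + y)" "in_deg A (x, y) = 0"
      "(x, y) \<notin> top_bottom_verts K L M N"
  | (RT) "x = row_right y" "int K - int M \<le> y" "even (x + y)" "out_deg A (x, y) = 0"
      "(x, y) \<notin> top_bottom_verts K L M N"
  | (RB) "x = row_right y" "y < int K - int M" "odd (x + y)" "out_deg A (x, y) = 0"
      "(x, y) \<notin> top_bottom_verts K L M N"
  | (T) "row_left y < x" "x < row_right y" "y = int K - 1" "even (x + y)"
      "in_deg A (x, y) + out_deg A (x, y) = 1" "(x, y) \<in> top_bottom_verts K L M N"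
  | (B) "row_left y < x" "x < row_right y" "y = int K - int M - int N" "odd (x + y)"
      "in_deg A (x, y) + out_deg A (x, y) = 1" "(x, y) \<in> top_bottom_verts K L M N"
  | (inner) "row_left y < x" "x < row_right y" "in_deg A (x, y) = 1" "out_deg A (x, y) = 1"
      "(x, y) \<notin> top_bottom_verts K L M N"
proof -
  have lr: "row_left y \<le> x" "x \<le> row_right y" using assms by (auto simp: H_rows)
  consider "x = row_left y" | "x = row_right y" | "row_left y < x" "x < row_right y"
    using lr by linarith
  then show thesis
  proof cases
    case 1
    then have l: "(x, y) \<in> left_verts K L M N"
      using assms by (auto simp: left_iff row_left_def max_def)
    then have "in_deg A (x, y) = 0" "(x, y) \<notin> top_bottom_verts K L M N"
      using left_vert_deg(1)[OF l] by (auto simp: top_bottom_iff)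
    then show thesis using 1 by (cases "0 \<le> y") (auto simp: row_left_def intro: LT LB)
  next
    case 2
    then have r: "(x, y) \<in> right_verts K L M N"
      using assms by (auto simp: right_iff row_right_def min_def)
    then have "out_deg A (x, y) = 0" "(x, y) \<notin> top_bottom_verts K L M N"
      using right_vert_deg(1)[OF r] by (auto simp: top_bottom_iff)
    then show thesis using 2
      by (cases "int K - int M \<le> y") (auto simp: row_right_def min_def intro: RT RB)
  next
    case 3
    then have lr: "(x, y) \<notin> left_verts K L M N" "(x, y) \<notin> right_verts K L M N"
      by (auto simp: left_iff right_iff row_left_def row_right_def)
    show thesis
    proof (cases "(x, y) \<in> top_bottom_verts K L M N")
      case True
      with top_bottom_deg[OF True] 3 show thesis
        using T B unfolding top_bottom_iff by blast
    next
      case False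
      with inner_deg[OF assms] lr 3 show thesis using inner by blast
    qed
  qed
qed

lemma arc_side:
  "x = row_left y \<Longrightarrow> arc x y (x - 1) y = 0 \<and> arc (x - 1) y x y = 0"
  "x = row_right y \<Longrightarrow> arc x y (x + 1) y = 0 \<and> arc (x + 1) y x y = 0"
  "arc x (int K - 1) x (int K) = 0" "arc x (int K) x (int K - 1) = 0"
  "arc x (int K - int M - int N) x (int K - int M - int N - 1) = 0"
  "arc x (int K - int M - int N - 1) x (int K - int M - int N) = 0"
  by (simp_all add: arc_outside H_rows)

text \<open>Where the matching and the reference matching both cover a vertex, or both miss it, the
  balance is immediate. A boundary vertex covered by the reference matching alone is the end of a
  path, and the exit term or the horizontal continuation supplies the missing unit.\<close>

lemma conservation1:
  assumes "y \<in> rows"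
  shows "g1 (x - 1) y + v1 x y = g1 x y + v1 x (y + 1)"
proof (cases "(x, y) \<in> H")
  case False
  then have "(x, y) \<notin> top_bottom_verts K L M N" by (auto simp: top_bottom_iff)
  then have "v1 x y = 0" "v1 x (y + 1) = 0"
    using assms arc_outside False by (auto simp: v1_def exitT_def exitB_def)
  moreover have "x < row_left y \<or> row_right y < x" using False assms by (auto simp: H_rows)
  ultimately show ?thesis using row_left_less_right[OF assms] by (auto simp: g1_def)
next
  case True
  then show ?thesis
    by (cases rule: vertex_cases)
      (use out_deg_arcs[of x y] in_deg_arcs[of x y] arc_side(1,2)[of x y] arc_side(3-6)[of x]
        row_left_less_right[OF assms] assms in \<open>auto simp: g1_def v1_def exitT_def exitB_def\<close>)
qed

lemma conservation2:
  assumes "y \<in> rows"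
  shows "g2 (x - 1) y + v2 x y = g2 x y + v2 x (y + 1)"
proof (cases "(x, y) \<in> H")
  case False
  then have "(x, y) \<notin> top_bottom_verts K L M N" by (auto simp: top_bottom_iff)
  then have "v2 x y = 0" "v2 x (y + 1) = 0"
    using assms arc_outside False by (auto simp: v2_def exitT_def exitB_def)
  moreover have "x < row_left y \<or> row_right y < x" using False assms by (auto simp: H_rows)
  ultimately show ?thesis using row_left_less_right[OF assms] by (auto simp: g2_def)
next
  case True
  then show ?thesis
    by (cases rule: vertex_cases)
      (use out_deg_arcs[of x y] in_deg_arcs[of x y] arc_side(1,2)[of x y] arc_side(3-6)[of x]
        row_left_less_right[OF assms] assms in \<open>auto simp: g2_def v2_def exitT_def exitB_def\<close>)
qed

section \<open>Signs of the flows and the local crossing bound\<close>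

lemma v1_range: "even (x + y) \<Longrightarrow> v1 x y \<le> 0" "odd (x + y) \<Longrightarrow> 0 \<le> v1 x y"
  "even (x + y) \<Longrightarrow> v2 x y \<le> 0" "odd (x + y) \<Longrightarrow> 0 \<le> v2 x y"
  by (auto simp: v1_def v2_def exitT_def exitB_def)

lemma g_range: "g1 x y \<le> 0" "0 \<le> g2 x y"
  using deg_le_1 by (auto simp: g1_def g2_def of_nat_diff)

definition "side_out = {v \<in> H. even (sum_coord v) \<and> (v, (fst v - 1, snd v)) \<in> A}"
definition "side_in = {v \<in> H. odd (sum_coord v) \<and>
  ((v, (fst v - 1, snd v)) \<in> A \<or> (v, (fst v, snd v + 1)) \<in> A)}"

text \<open>The vertical factors have signs fixed by parity and the horizontal ones have constant
  sign, so at each vertex at most one product contributes positively. For even \<open>x + y\<close>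
  it is the second, whose horizontal factor demands an outgoing arc to the left. For odd
  \<open>x + y\<close> it is the first: \<open>v1 x y = 1\<close> blocks the way down and
  \<open>g2 x y = 1\<close> the way right, so the outgoing arc goes left or up.\<close>

lemma local_bound:
  assumes y: "y \<in> rows"
  shows "g2 x y * v1 x y - g1 (x - 1) y * v2 x (y + 1)
    \<le> of_bool ((x, y) \<in> side_out) + of_bool ((x, y) \<in> side_in)"
proof (cases "(x, y) \<in> H")
  case False
  then have "(x, y) \<notin> top_bottom_verts K L M N" by (auto simp: top_bottom_iff)
  then have "v1 x y = 0" "v2 x (y + 1) = 0"
    using y arc_outside False by (auto simp: v1_def v2_def exitT_def exitB_def)
  then show ?thesis by simp
next
  case True
  show ?thesis
  proof (cases "even (x + y)")
    case ev: True
    have "g2 x y * v1 x y \<le> 0"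
      using v1_range(1)[OF ev] g_range by (simp add: mult_le_0_iff)
    moreover have "- g1 (x - 1) y * v2 x (y + 1) \<le> of_bool ((x, y) \<in> side_out)"
    proof -
      have v2: "v2 x (y + 1) = arc x (y + 1) x y + exitT x (y + 1) (in_deg A (x, y))"
        using y ev by (auto simp: v2_def exitB_def)
      \<comment> \<open>Below the top row the exit term vanishes, and on the top row the vertex
        above is outside the hexagon, so at most one summand is nonzero.\<close>
      have ex: "exitT x (y + 1) (in_deg A (x, y)) + arc x (y + 1) x y \<le> 1"
        using arc_side(4)[of x] arc_bounds(2)[of x "y + 1" x y]
        by (cases "y = int K - 1") (auto simp: exitT_def)
      show ?thesis
      proof (cases "row_left y < x")
        case True
        then have "- g1 (x - 1) y = arc x y (x - 1) y"
          using \<open>(x, y) \<in> H\<close> ev by (auto simp: g1_def H_rows)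
        moreover have "arc x y (x - 1) y = of_bool ((x, y) \<in> side_out)"
          using \<open>(x, y) \<in> H\<close> ev by (auto simp: arc_def side_out_def)
        ultimately show ?thesis using v2 ex v1_range(4)[of x "y + 1"] ev
          by (auto simp: mult_le_0_iff)
      next
        case False
        then have l: "(x, y) \<in> left_verts K L M N" "(x, y) \<notin> top_bottom_verts K L M N"
          using \<open>(x, y) \<in> H\<close> by (auto simp: left_iff top_bottom_iff H_rows row_left_def max_def split: if_splits)
        then have "v2 x (y + 1) = 0"
          using v2 no_arc_to_left[of "((x, y + 1), (x, y))"] by (auto simp: arc_def exitT_def)
        then show ?thesis by simp
      qed
    qed
    ultimately show ?thesis by simp
  next
    case od: False
    have "0 \<le> g1 (x - 1) y * v2 x (y + 1)"
      using v1_range(3)[of x "y + 1"] g_range(1)[of "x - 1" y] od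
      by (simp add: zero_le_mult_iff)
    moreover have "g2 x y * v1 x y \<le> of_bool ((x, y) \<in> side_in)"
    proof -
      have v1: "v1 x y = arc x (y - 1) x y + exitB x y (in_deg A (x, y))"
        using y od by (auto simp: v1_def exitT_def)
      have ex: "exitB x y (in_deg A (x, y)) + arc x (y - 1) x y \<le> 1"
        using arc_side(6)[of x] arc_bounds(2)[of x "y - 1" x y] by (auto simp: exitB_def)
      consider "v1 x y = 0" | "v1 x y = 1" using v1 ex v1_range(2)[of x y] od by linarith
      then show ?thesis
      proof cases
        case 2
        have side: "arc x y (x - 1) y + arc x y x (y + 1) \<le> of_bool ((x, y) \<in> side_in)"
        proof -
          have "int (out_deg A (x, y)) \<le> 1" using deg_le_1[of "(x, y)"] by simp
          then have "arc x y (x - 1) y + arc x y x (y + 1) \<le> 1"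
            using out_deg_arcs[of x y] arc_bounds(1)[of x y "x + 1" y] arc_bounds(1)[of x y x "y - 1"]
            by linarith
          then show ?thesis using \<open>(x, y) \<in> H\<close> od by (auto simp: arc_def side_in_def)
        qed
        \<comment> \<open>A unit of \<open>v1\<close> is an arc from below or an exit of a bottom
          vertex. Lower left vertices are never entered, and below a lower right vertex the hexagon
          ends; in the other cases the out-degree is one. An arc down would reverse the arc from
          below or leave the hexagon.\<close>
        have out: "out_deg A (x, y) = 1 \<and> arc x y x (y - 1) = 0 \<and> x < row_right y \<and> row_left y \<le> x"
          using \<open>(x, y) \<in> H\<close>
        proof (cases rule: vertex_cases)
          case LB
          have "arc x (y - 1) x y = 0"
            using in_deg_arcs[of x y] LB(4) arc_bounds(1)[of "x + 1" y x y] arc_bounds(1)[of "x - 1" y x y]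
              arc_bounds(1)[of x "y + 1" x y] arc_bounds(1)[of x "y - 1" x y] by linarith
          with 2 v1 LB show ?thesis by (simp add: exitB_def)
        next
          case RB
          then have "(x, y - 1) \<notin> H" by (auto simp: H_rows row_right_def)
          with 2 v1 RB show ?thesis by (auto simp: exitB_def arc_outside)
        next
          case B
          with 2 v1 arc_side(5,6)[of x] show ?thesis by (auto simp: exitB_def)
        next
          case inner
          with 2 v1 arc_asym[of x y x "y - 1"] arc_bounds(1)[of x y x "y - 1"]
          show ?thesis by (auto simp: exitB_def)
        qed (use od in auto)
        then have "g2 x y = 1 - arc x y (x + 1) y" using od by (auto simp: g2_def)
        also have "\<dots> = arc x y (x - 1) y + arc x y x (y + 1)"
          using out_deg_arcs[of x y] out by simp
        finally show ?thesis using side 2 by simp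
      qed simp
    qed
    ultimately show ?thesis
      using zero_less_eq_of_bool[of "(x, y) \<in> side_out", where ?'a = int] by linarith
  qed
qed

text \<open>A crude bound beyond all row ends: column \<open>x_end - 1\<close> lies to the right of
  the hexagon, where \<open>g1\<close> and \<open>g2\<close> have reached their continued
  values.\<close>

definition "x_end = 2 * (int K + int L + int M + int N) + 2"

lemma H_box: "(x, y) \<in> H \<Longrightarrow> 0 \<le> x \<and> x < x_end - 1"
  by (auto simp: H_rows row_left_def row_right_def x_end_def)

lemma crossing_bound:
  "(\<Sum>y\<in>rows. \<Sum>x\<in>{0..<x_end}. g2 x y * v1 x y - g1 (x - 1) y * v2 x (y + 1))
    \<le> int (card side_out) + int (card side_in)"
proof -
  let ?R = "rows \<times> {0..<x_end}"
  have sub: "(\<Sum>(y, x)\<in>?R. of_bool ((x, y) \<in> S)) = int (card S)" if "S \<subseteq> H" for S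
  proof -
    have fin: "finite S" using that finite_H_verts by (rule finite_subset)
    have "(\<Sum>(y, x)\<in>?R. of_bool ((x, y) \<in> S)) = (\<Sum>p\<in>?R. of_bool (prod.swap p \<in> S))"
      by (rule sum.cong) auto
    also have "\<dots> = int (card {p \<in> ?R. prod.swap p \<in> S})" by (simp add: Int_def)
    also have "card {p \<in> ?R. prod.swap p \<in> S} = card (prod.swap ` S)"
      using that H_box H_rows by (intro arg_cong[of _ _ card]) (fastforce simp: image_iff)
    also have "\<dots> = card S" by (simp add: card_image)
    finally show ?thesis .
  qed
  have "(\<Sum>y\<in>rows. \<Sum>x\<in>{0..<x_end}. g2 x y * v1 x y - g1 (x - 1) y * v2 x (y + 1))
    \<le> (\<Sum>y\<in>rows. \<Sum>x\<in>{0..<x_end}. of_bool ((x, y) \<in> side_out) + of_bool ((x, y) \<in> side_in))"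
    by (intro sum_mono local_bound)
  also have "\<dots> = (\<Sum>(y, x)\<in>?R. of_bool ((x, y) \<in> side_out)) + (\<Sum>(y, x)\<in>?R. of_bool ((x, y) \<in> side_in))"
    by (simp only: sum.cartesian_product sum.distrib)
  also have "\<dots> = int (card side_out) + int (card side_in)"
    using sub[of side_out] sub[of side_in] by (simp add: side_out_def side_in_def)
  finally show ?thesis .
qed

lemma side_cards:
  "card side_out \<le> card {a \<in> A. even (sum_coord (fst a)) \<and> sum_coord (snd a) = sum_coord (fst a) - 1}"
  "card side_in \<le> card {a \<in> A. odd (sum_coord (fst a)) \<and> diff_coord (snd a) = diff_coord (fst a) - 1}"
proof -
  have "side_out \<subseteq> fst ` {a \<in> A. even (sum_coord (fst a)) \<and> sum_coord (snd a) = sum_coord (fst a) - 1}"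
    by (force simp: side_out_def image_iff)
  then show "card side_out \<le> card {a \<in> A. even (sum_coord (fst a)) \<and> sum_coord (snd a) = sum_coord (fst a) - 1}"
    using finite_A by (intro surj_card_le) auto
  have "side_in \<subseteq> fst ` {a \<in> A. odd (sum_coord (fst a)) \<and> diff_coord (snd a) = diff_coord (fst a) - 1}"
    by (force simp: side_in_def image_iff)
  then show "card side_in \<le> card {a \<in> A. odd (sum_coord (fst a)) \<and> diff_coord (snd a) = diff_coord (fst a) - 1}"
    using finite_A by (intro surj_card_le) auto
qed

section \<open>Boundary values of the flows and the total crossing number\<close>

lemma top_level:
  shows "x \<notin> (\<lambda>i. int K + 1 + 2 * int i) ` {..<length t} \<Longrightarrow> v1 x (int K) = 0 \<and> v2 x (int K) = 0"
    and "i < length t \<Longrightarrow> v1 (int K + 1 + 2 * int i) (int K) = of_bool (t ! i = 0)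
      \<and> v2 (int K + 1 + 2 * int i) (int K) = of_bool (t ! i = 1)"
proof -
  assume x: "x \<notin> (\<lambda>i. int K + 1 + 2 * int i) ` {..<length t}"
  have "\<not> (odd (x + int K) \<and> (x, int K - 1) \<in> top_bottom_verts K L M N)"
  proof
    assume *: "odd (x + int K) \<and> (x, int K - 1) \<in> top_bottom_verts K L M N"
    then have "odd (x - int K)" by simp
    then obtain j where j: "x - int K = 2 * j + 1" by (blast elim: oddE)
    have "x \<noteq> int K - 1" "x \<noteq> int K + 2 * int L + 1" "(x, int K - 1) \<in> H"
      using * by (auto simp: top_bottom_iff left_iff right_iff)
    then have "0 \<le> j" "j < int L" using j by (auto simp: H_iff)
    then have "x = int K + 1 + 2 * int (nat j)" "nat j < length t" using j by (auto simp: lengths)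
    with x show False by blast
  qed
  then show "v1 x (int K) = 0 \<and> v2 x (int K) = 0"
    using sizes arc_side(3,4)[of x] by (auto simp: v1_def v2_def exitT_def exitB_def)
next
  assume "i < length t"
  then have "i < L" by (simp add: lengths)
  from t_nth[OF this] show "v1 (int K + 1 + 2 * int i) (int K) = of_bool (t ! i = 0)
      \<and> v2 (int K + 1 + 2 * int i) (int K) = of_bool (t ! i = 1)"
    using sizes arc_side(3,4) by (auto simp: v1_def v2_def exitT_def exitB_def bit_not_one_iff)
qed

lemma bottom_level:
  shows "x \<notin> (\<lambda>i. int M + int N - int K + 1 + 2 * int i) ` {..<length b} \<Longrightarrow>
      v1 x (int K - int M - int N) = 0 \<and> v2 x (int K - int M - int N) = 0"
    and "i < length b \<Longrightarrow>
      v1 (int M + int N - int K + 1 + 2 * int i) (int K - int M - int N) = of_bool (b ! i = 0)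
      \<and> v2 (int M + int N - int K + 1 + 2 * int i) (int K - int M - int N) = of_bool (b ! i = 1)"
proof -
  let ?y = "int K - int M - int N"
  assume x: "x \<notin> (\<lambda>i. int M + int N - int K + 1 + 2 * int i) ` {..<length b}"
  have "\<not> (odd (x + ?y) \<and> (x, ?y) \<in> top_bottom_verts K L M N)"
  proof
    assume *: "odd (x + ?y) \<and> (x, ?y) \<in> top_bottom_verts K L M N"
    then obtain j where j: "x + ?y = 2 * j + 1" by (blast elim: oddE)
    have "x \<noteq> - ?y - 1" "x \<noteq> ?y + 2 * (int M + int L) + 1" "(x, ?y) \<in> H"
      using * by (auto simp: top_bottom_iff left_iff right_iff)
    then have "0 \<le> j" "j < int K + int L - int N" using j by (auto simp: H_iff)
    then have "x = int M + int N - int K + 1 + 2 * int (nat j)" "nat j < length b"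
      using j sizes by (auto simp: lengths)
    with x show False by blast
  qed
  then show "v1 x ?y = 0 \<and> v2 x ?y = 0"
    using sizes arc_side(5,6)[of x] by (auto simp: v1_def v2_def exitT_def exitB_def)
next
  assume "i < length b"
  then have "i < K + L - N" by (simp add: lengths)
  from b_nth[OF this] show
    "v1 (int M + int N - int K + 1 + 2 * int i) (int K - int M - int N) = of_bool (b ! i = 0)
      \<and> v2 (int M + int N - int K + 1 + 2 * int i) (int K - int M - int N) = of_bool (b ! i = 1)"
    using sizes arc_side(5,6) by (auto simp: v1_def v2_def exitT_def exitB_def bit_not_one_iff)
qed

text \<open>A one of \<open>t\<close> has to its left the earlier zeros of \<open>t\<close> and all
  zeros of \<open>l_T\<close>; a one of \<open>r_T\<close> has all zeros of \<open>l_T t\<close>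
  before it. The bottom level contributes with negative sign the zeros of \<open>b\<close> that
  precede a one of \<open>b\<close>.\<close>

lemma crossing_identity:
  "(\<Sum>y\<in>rows. \<Sum>x\<in>{0..<x_end}. g2 x y * v1 x y - g1 (x - 1) y * v2 x (y + 1))
    = int (count_list t 0) * int (count_list t 1) - int (inv_number t)
      + int (count_list lT 0) * int (count_list t 1)
      - (int (count_list b 0) * int (count_list b 1) - int (inv_number b))
      + (int (count_list t 0) + int (count_list lT 0)) * int (count_list rT 1)"
proof -
  define h where "h x y = (\<Sum>x'\<in>{0..<x}. v1 x' y) -
    (\<Sum>y'\<in>{int K - int M - int N..<y}. g1 (0 - 1) y')" for x y
  have ys: "int K - int M - int N \<le> int K" and xs: "0 \<le> x_end" by (auto simp: x_end_def)
  note cross = crossing_sum[where ?g1.0 = g1 and ?g2.0 = g2 and ?v1.0 = v1 and ?v2.0 = v2 and h = h,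
      OF xs ys conservation1 conservation2 h_def, simplified]
  have g1_left: "g1 (- 1) y = (if 0 \<le> y then int (out_deg A (y, y)) - 1 else 0)" for y
    by (auto simp: g1_def row_left_def)
  have g2_left: "g2 (- 1) y = 0" if "0 \<le> y" for y
    using that by (auto simp: g2_def row_left_def)
  have right: "row_left y < x_end - 1" "row_right y \<le> x_end - 1" if "y \<in> rows" for y
    using that by (auto simp: row_left_def row_right_def x_end_def)
  have lT_sum: "(\<Sum>y\<in>{int K - int M - int N..<int K}. g1 (- 1) y) = - int (count_list lT 0)"
  proof -
    have "(\<Sum>y\<in>rows. g1 (- 1) y) = (\<Sum>y\<in>int ` {..<K}. g1 (- 1) y)"
      using sizes by (intro sum.mono_neutral_right) (auto simp: g1_left image_iff intro: nonneg_int_cases)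
    also have "\<dots> = (\<Sum>i<K. - of_bool (lT ! i = 0))"
      by (subst sum.reindex) (auto simp: g1_left lT_nth bit_not_one_iff intro!: sum.cong)
    also have "\<dots> = - int (count_list lT 0)"
      using count_list_take[of K lT 0] by (simp add: sum_negf lengths)
    finally show ?thesis .
  qed
  \<comment> \<open>The first flow has no end on the lower left side, so the height there is still
    0; the second flow has none on the upper left side.\<close>
  have low: "h 0 y * g2 (- 1) y = 0" if "y \<in> rows" for y
  proof (cases "0 \<le> y")
    case False
    then have "h 0 y = 0" by (auto simp: h_def g1_left intro!: sum.neutral)
    then show ?thesis by simp
  qed (simp add: g2_left)
  have t_range: "0 \<le> int K + 1" "int K + 1 + 2 * int (length t) \<le> x_end"
    by (auto simp: x_end_def lengths)
  have b_range: "0 \<le> int M + int N - int K + 1"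
    "int M + int N - int K + 1 + 2 * int (length b) \<le> x_end"
    using sizes by (auto simp: x_end_def lengths)
  note top = pair_crossings[OF t_range, of "\<lambda>x. v1 x (int K)" "\<lambda>x. v2 x (int K)"]
  note bot = pair_crossings[OF b_range, of "\<lambda>x. v1 x (int K - int M - int N)"
      "\<lambda>x. v2 x (int K - int M - int N)"]
  have h_top: "h x (int K) = (\<Sum>x'\<in>{0..<x}. v1 x' (int K)) + int (count_list lT 0)" for x
    using lT_sum by (simp add: h_def)
  have S_top: "(\<Sum>x\<in>{0..<x_end}. h x (int K) * v2 x (int K))
      = int (count_list t 0) * int (count_list t 1) - int (inv_number t)
        + int (count_list lT 0) * int (count_list t 1)"
    unfolding h_top by (rule top(1)) (use top_level in auto)
  have h_end: "h x_end (int K) = int (count_list t 0) + int (count_list lT 0)"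
    unfolding h_top by (subst top(2)) (use top_level in auto)
  have S_bot: "(\<Sum>x\<in>{0..<x_end}. h x (int K - int M - int N) * v2 x (int K - int M - int N))
      = int (count_list b 0) * int (count_list b 1) - int (inv_number b)"
    using bot(1)[of 0] bottom_level by (simp add: h_def)
  have g1_right: "g1 (x_end - 1) y = 0" if "y \<in> rows" "int K - int M \<le> y" for y
    using right[OF that(1)] that by (simp add: g1_def)
  \<comment> \<open>On the right the second flow ends only in rows \<open>y >= K - M\<close>. There
    the first flow has no end, so the height keeps its value from the top right corner.\<close>
  have h_const: "h x_end y = h x_end (int K)"
    if "int K - int M \<le> y" "int K - int M - int N \<le> y" "y \<le> int K" for y
    using that(3,1,2)
  proof (induction y rule: int_le_induct)
    case (step i)
    then show ?case using cross(2)[of "i - 1"] g1_right[of "i - 1"] by simp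
  qed simp
  have high: "h x_end y * g2 (x_end - 1) y
      = (int (count_list t 0) + int (count_list lT 0)) * g2 (x_end - 1) y" if "y \<in> rows" for y
  proof (cases "int K - int M \<le> y")
    case True
    with that show ?thesis using h_const[of y] h_end by simp
  next
    case False
    then have "g2 (x_end - 1) y = 0" using right[OF that] by (simp add: g2_def)
    then show ?thesis by simp
  qed
  have rT_sum: "(\<Sum>y\<in>rows. g2 (x_end - 1) y) = int (count_list rT 1)"
  proof -
    have "(\<Sum>y\<in>rows. g2 (x_end - 1) y) = (\<Sum>y\<in>(\<lambda>i. int K - 1 - int i) ` {..<M}. g2 (x_end - 1) y)"
    proof (intro sum.mono_neutral_right ballI)
      fix y assume y: "y \<in> rows - (\<lambda>i. int K - 1 - int i) ` {..<M}"
      have "y < int K - int M"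
      proof (rule ccontr)
        assume "\<not> y < int K - int M"
        with y have "y = int K - 1 - int (nat (int K - 1 - y))" "nat (int K - 1 - y) < M" by auto
        with y show False by blast
      qed
      then show "g2 (x_end - 1) y = 0" using right[of y] y by (simp add: g2_def)
    qed (auto)
    also have "\<dots> = (\<Sum>i<M. g2 (x_end - 1) (int K - 1 - int i))"
      by (subst sum.reindex) (auto simp: inj_on_def)
    also have "\<dots> = (\<Sum>i<M. of_bool (rT ! i = 1))"
    proof (rule sum.cong[OF refl])
      fix i assume i: "i \<in> {..<M}"
      let ?y = "int K - 1 - int i"
      have "row_right ?y = int K + 2 * int L + int i + 1" using i by (auto simp: row_right_def)
      with i rT_nth[of i] right[of ?y] show "g2 (x_end - 1) ?y = of_bool (rT ! i = 1)"
        by (auto simp: g2_def bit_not_one_iff)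
    qed
    also have "\<dots> = int (count_list rT 1)"
      using count_list_take[of M rT 1] by (simp add: lengths)
    finally show ?thesis .
  qed
  have "(\<Sum>y\<in>rows. (\<Sum>x\<in>{0..<x_end}. g2 x y * v1 x y - g1 (x - 1) y * v2 x (y + 1))
      + h 0 y * g2 (- 1) y - h x_end y * g2 (x_end - 1) y)
    = (\<Sum>y\<in>rows. (\<Sum>x\<in>{0..<x_end}. g2 x y * v1 x y - g1 (x - 1) y * v2 x (y + 1))
      - (int (count_list t 0) + int (count_list lT 0)) * g2 (x_end - 1) y)"
    by (rule sum.cong[OF refl]) (simp add: low high)
  also have "\<dots> = (\<Sum>y\<in>rows. (\<Sum>x\<in>{0..<x_end}. g2 x y * v1 x y - g1 (x - 1) y * v2 x (y + 1)))
      - (int (count_list t 0) + int (count_list lT 0)) * int (count_list rT 1)"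
    by (simp only: sum_subtractf[of _ "\<lambda>y. _ * g2 (x_end - 1) y"] sum_distrib_left[symmetric] rT_sum)
  finally show ?thesis using cross(1) S_top S_bot by linarith
qed

lemma inversion_bound:
  "int (inv_number rB) + int (inv_number b) + int (inv_number lB) \<ge>
     int (inv_number lT) + int (inv_number t) + int (inv_number rT)
     + int (count_list lT 1) * int (count_list t 0)
     + int (count_list t 1) * int (count_list rT 0)
     + int (count_list rB 0) * int (count_list lB 1)"
proof -
  have ones: "int (count_list t 1) + int (count_list rT 1) = int (count_list lB 1) + int (count_list b 1)"
    using count_shifts(6) count_list_bit_length[of "t @ rT"] count_list_bit_length[of "lB @ b"]
      lengths sizes by auto
  have zeros: "int (count_list lT 0) + int (count_list t 0) = int (count_list b 0) + int (count_list rB 0)"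
    using count_shifts(5) by simp
  \<comment> \<open>This nonlinear consequence of part (1) trades top letters for bottom letters;
    its expansion is the source of \<open>|r_B|_0 |l_B|_1\<close>.\<close>
  have "(int (count_list t 1) + int (count_list rT 1)) * (int (count_list lT 0) + int (count_list t 0))
    = (int (count_list lB 1) + int (count_list b 1)) * (int (count_list b 0) + int (count_list rB 0))"
    by (simp only: ones zeros)
  with crossing_identity crossing_bound side_cards count_shifts(1,2)
  show ?thesis by (simp add: inv_number_append algebra_simps)
qed

end

theorem theorem2p7:
  fixes K L M N :: nat
    and lT t rT rB b lB :: word
  assumes "K \<le> M + N" and "N \<le> K + L" and "M + N \<ge> 1"
    and "length lT = K" and "length t = L" and "length rT = M"
    and "length rB = N" and "length b = K + L - N" and "length lB = M + N - K"
    and "\<exists>f A. oriented_hfpl K L M N f A \<and> boundary K L M N A = (lT, t, rT, rB, b, lB)"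
  shows "(count_list lT 0 + count_list t 0 = count_list rB 0 + count_list b 0 \<and>
          count_list t 1 + count_list rT 1 = count_list b 1 + count_list lB 1) \<and>
         (word_le (lT @ t) (b @ rB) \<and> word_le (t @ rT) (lB @ b)) \<and>
         inv_number rB + inv_number b + inv_number lB \<ge>
           inv_number lT + inv_number t + inv_number rT
           + count_list lT 1 * count_list t 0
           + count_list t 1 * count_list rT 0
           + count_list rB 0 * count_list lB 1"
proof -
  obtain f A where "oriented_hfpl K L M N f A" "boundary K L M N A = (lT, t, rT, rB, b, lB)"
    using assms(10) by blast
  then interpret oriented_hexagon K L M N f A lT t rT rB b lB
    using assms(1-3) by unfold_locales auto
  have "count_list t 1 + count_list rT 1 = count_list b 1 + count_list lB 1"
    using count_shifts(4) by (simp add: word_le_def)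
  moreover have "count_list lT 0 + count_list t 0 = count_list rB 0 + count_list b 0"
    using count_shifts(5) by simp
  moreover have "inv_number rB + inv_number b + inv_number lB \<ge>
      inv_number lT + inv_number t + inv_number rT + count_list lT 1 * count_list t 0
      + count_list t 1 * count_list rT 0 + count_list rB 0 * count_list lB 1"
    using inversion_bound by (simp flip: of_nat_add of_nat_mult)
  ultimately show ?thesis using count_shifts(3,4) by blast
qed

end
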